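(* Let $(W,S)$ be a Coxeter system of finite rank with a fixed reflection representation, and $c$ a Coxeter element. The following maps, defined on the set of $c$-sortable elements of $W$, are injective: (i) $v\mapsto\mathrm{nc}_c(v)\in W$; (ii) $v\mapsto\mathrm{Fix}(\mathrm{nc}_c(v))$, a subspace of $V^*$; (iii) $v\mapsto\mathrm{Stab}(\mathrm{Fix}(\mathrm{nc}_c(v)))$, a (parabolic) subgroup of $W$; (iv) $v\mapsto\mathrm{cov}(v)$, a set of reflections.
   Context: $T$ = reflections; $\mathrm{inv}(w)=\{t\in T:\ell(tw)<\ell(w)\}$; $\mathrm{cov}(w)=\{t\in\mathrm{inv}(w):tw=ws\text{ for some }s\in S\}$. Coxeter element $c=s_1\cdots s_n$ (all of $S$ in some order); the $c$-sorting word of $w$ is the lexicographically first (by positions) subword of $(s_1\cdots s_n)^\infty$ that is a reduced word for $w$; $w$ is $c$-sortable if the sets of letters in successive copies of $s_1\cdots s_n$ weakly decrease under inclusion. The reflection sequence of a reduced word $a_1\cdots a_k$ is $t_i=a_1\cdots a_{i-1}a_ia_{i-1}\cdots a_1$; every inversion of $v$ occurs exactly once in the reflection sequence of any reduced word for $v$. For $c$-sortable $v$, let $u_1,\dots,u_r$ be the cover reflections of $v$ listed in the order they appear in the reflection sequence of a $c$-sorting word for $v$; then $\mathrm{nc}_c(v)=u_1u_2\cdots u_r$. Reflection representation: $V$ with basis $\{\alpha_s\}$, $s\alpha_{s'}=\alpha_{s'}-a_{ss'}\alpha_s$ for a symmetrizable generalized Cartan matrix $A=(a_{ss'})$ ($a_{ss}=2$;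 for $s\neq s'$, $a_{ss'}\le 0$, $a_{ss'}a_{s's}=4\cos^2(\pi/m(s,s'))$ if $m(s,s')<\infty$, $\ge 4$ otherwise; $a_{ss'}=0\iff a_{s's}=0$; positive $\delta$ with $\delta(s)a_{ss'}=\delta(s')a_{s's}$, constant on conjugate simple reflections); $V^*$ its dual with the dual action. $\mathrm{Fix}(x)=\{x^*\in V^*: xx^*=x^*\}$, and for a subspace $U\subseteq V^*$, $\mathrm{Stab}(U)$ is the subgroup of $W$ fixing $U$ pointwise. *)

theory Defs
  imports Complex_Main "HOL-Library.Extended_Nat" "HOL-Algebra.Group"
begin

section \<open>Coxeter systems\<close>

definition coxeter_matrix :: "'a set \<Rightarrow> ('a \<Rightarrow> 'a \<Rightarrow> enat) \<Rightarrow> bool" where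
  "coxeter_matrix S m \<longleftrightarrow>
     (\<forall>s\<in>S. m s s = 1) \<and>
     (\<forall>s\<in>S. \<forall>t\<in>S. s \<noteq> t \<longrightarrow> m s t = m t s \<and> 2 \<le> m s t)"

text \<open>
  The congruence on words over \<open>S\<close> generated by the Coxeter relations \<open>(s t)\<^bsup>m(s,t)\<^esup> = 1\<close>,
  for \<open>m(s,t)\<close> finite.  As \<open>m(s,s) = 1\<close>, every generator is its own inverse modulo this congruence,
  so the quotient of the free monoid on \<open>S\<close> by it is the group presented by these relations.
\<close>

inductive coxeter_cong :: "'a set \<Rightarrow> ('a \<Rightarrow> 'a \<Rightarrow> enat) \<Rightarrow> 'a list \<Rightarrow> 'a list \<Rightarrow> bool"
  for S m where
  relation: "\<lbrakk>s \<in> S; t \<in> S; m s t = enat k; set x \<subseteq> S; set y \<subseteq> S\<rbrakk>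
     \<Longrightarrow> coxeter_cong S m (x @ concat (replicate k [s, t]) @ y) (x @ y)"
| refl: "set x \<subseteq> S \<Longrightarrow> coxeter_cong S m x x"
| sym: "coxeter_cong S m x y \<Longrightarrow> coxeter_cong S m y x"
| trans: "\<lbrakk>coxeter_cong S m x y; coxeter_cong S m y z\<rbrakk> \<Longrightarrow> coxeter_cong S m x z"

definition word_prod :: "('a, 'b) monoid_scheme \<Rightarrow> 'a list \<Rightarrow> 'a" where
  "word_prod G x = foldr (\<lambda>a b. a \<otimes>\<^bsub>G\<^esub> b) x \<one>\<^bsub>G\<^esub>"

text \<open>\<open>G\<close> is the group with generating set \<open>S\<close> and presentation given by the Coxeter relations.\<close>

locale coxeter_system = group G for G (structure) +
  fixes S :: "'a set" and m :: "'a \<Rightarrow> 'a \<Rightarrow> enat"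
  assumes matrix: "coxeter_matrix S m"
    and gens_closed: "S \<subseteq> carrier G"
    and generates: "w \<in> carrier G \<Longrightarrow> \<exists>x. set x \<subseteq> S \<and> word_prod G x = w"
    and presentation: "\<lbrakk>set x \<subseteq> S; set y \<subseteq> S\<rbrakk>
      \<Longrightarrow> word_prod G x = word_prod G y \<longleftrightarrow> coxeter_cong S m x y"

definition cox_length :: "('a, 'b) monoid_scheme \<Rightarrow> 'a set \<Rightarrow> 'a \<Rightarrow> nat" where
  "cox_length G S w = (LEAST k. \<exists>x. set x \<subseteq> S \<and> length x = k \<and> word_prod G x = w)"

definition reduced_word_for :: "('a, 'b) monoid_scheme \<Rightarrow> 'a set \<Rightarrow> 'a \<Rightarrow> 'a list \<Rightarrow> bool" where
  "reduced_word_for G S w x \<longleftrightarrow>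
     set x \<subseteq> S \<and> word_prod G x = w \<and> length x = cox_length G S w"

definition reflections :: "('a, 'b) monoid_scheme \<Rightarrow> 'a set \<Rightarrow> 'a set" where
  "reflections G S = {w \<otimes>\<^bsub>G\<^esub> s \<otimes>\<^bsub>G\<^esub> inv\<^bsub>G\<^esub> w | w s. w \<in> carrier G \<and> s \<in> S}"

definition inversions :: "('a, 'b) monoid_scheme \<Rightarrow> 'a set \<Rightarrow> 'a \<Rightarrow> 'a set" where
  "inversions G S w =
     {t \<in> reflections G S. cox_length G S (t \<otimes>\<^bsub>G\<^esub> w) < cox_length G S w}"

definition cov :: "('a, 'b) monoid_scheme \<Rightarrow> 'a set \<Rightarrow> 'a \<Rightarrow> 'a set" where
  "cov G S w = {t \<in> inversions G S w. \<exists>s\<in>S. t \<otimes>\<^bsub>G\<^esub> w = w \<otimes>\<^bsub>G\<^esub> s}"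

definition reflection_sequence :: "('a, 'b) monoid_scheme \<Rightarrow> 'a list \<Rightarrow> 'a list" where
  "reflection_sequence G x =
     map (\<lambda>i. word_prod G (take i x @ [x ! i] @ rev (take i x))) [0..<length x]"

section \<open>Sortable elements\<close>

text \<open>
  A Coxeter element \<open>c = s\<^sub>1 \<cdots> s\<^sub>n\<close> is given by the list \<open>c = [s\<^sub>1, \<dots>, s\<^sub>n]\<close> enumerating \<open>S\<close>.
  A subword of \<open>(s\<^sub>1 \<cdots> s\<^sub>n)\<^sup>\<infinity>\<close> is given by its increasing list of positions, counted
  from 0; position \<open>i\<close> lies in copy \<open>i div n\<close>.
\<close>

definition coxeter_word :: "'a set \<Rightarrow> 'a list \<Rightarrow> bool" where
  "coxeter_word S c \<longleftrightarrow> distinct c \<and> set c = S"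

definition letter_at :: "'a list \<Rightarrow> nat \<Rightarrow> 'a" where
  "letter_at c i = c ! (i mod length c)"

definition reduced_positions ::
  "('a, 'b) monoid_scheme \<Rightarrow> 'a set \<Rightarrow> 'a list \<Rightarrow> 'a \<Rightarrow> nat list \<Rightarrow> bool" where
  "reduced_positions G S c w p \<longleftrightarrow>
     sorted_wrt (<) p \<and> reduced_word_for G S w (map (letter_at c) p)"

definition sorting_positions ::
  "('a, 'b) monoid_scheme \<Rightarrow> 'a set \<Rightarrow> 'a list \<Rightarrow> 'a \<Rightarrow> nat list" where
  "sorting_positions G S c w =
     (THE p. reduced_positions G S c w p \<and>
        (\<forall>q. reduced_positions G S c w q \<longrightarrow> q = p \<or> (p, q) \<in> lexord less_than))"

definition sorting_word ::
  "('a, 'b) monoid_scheme \<Rightarrow> 'a set \<Rightarrow> 'a list \<Rightarrow> 'a \<Rightarrow> 'a list" where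
  "sorting_word G S c w = map (letter_at c) (sorting_positions G S c w)"

definition sorting_block ::
  "('a, 'b) monoid_scheme \<Rightarrow> 'a set \<Rightarrow> 'a list \<Rightarrow> 'a \<Rightarrow> nat \<Rightarrow> 'a set" where
  "sorting_block G S c w j =
     letter_at c ` {i \<in> set (sorting_positions G S c w). i div length c = j}"

definition sortable :: "('a, 'b) monoid_scheme \<Rightarrow> 'a set \<Rightarrow> 'a list \<Rightarrow> 'a set" where
  "sortable G S c =
     {w \<in> carrier G. \<forall>j. sorting_block G S c w (Suc j) \<subseteq> sorting_block G S c w j}"

definition nc :: "('a, 'b) monoid_scheme \<Rightarrow> 'a set \<Rightarrow> 'a list \<Rightarrow> 'a \<Rightarrow> 'a" where
  "nc G S c v =
     word_prod G (filter (\<lambda>t. t \<in> cov G S v) (reflection_sequence G (sorting_word G S c v)))"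

section \<open>Reflection representations\<close>

definition conjugate_in :: "('a, 'b) monoid_scheme \<Rightarrow> 'a \<Rightarrow> 'a \<Rightarrow> bool" where
  "conjugate_in G s t \<longleftrightarrow> (\<exists>w\<in>carrier G. t = w \<otimes>\<^bsub>G\<^esub> s \<otimes>\<^bsub>G\<^esub> inv\<^bsub>G\<^esub> w)"

definition generalized_cartan_matrix ::
  "'a set \<Rightarrow> ('a \<Rightarrow> 'a \<Rightarrow> enat) \<Rightarrow> ('a \<Rightarrow> 'a \<Rightarrow> real) \<Rightarrow> bool" where
  "generalized_cartan_matrix S m A \<longleftrightarrow>
     (\<forall>s\<in>S. A s s = 2) \<and>
     (\<forall>s\<in>S. \<forall>t\<in>S. s \<noteq> t \<longrightarrow>
        A s t \<le> 0 \<and>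
        (case m s t of
           enat k \<Rightarrow> A s t * A t s = 4 * (cos (pi / real k))\<^sup>2
         | \<infinity> \<Rightarrow> A s t * A t s \<ge> 4) \<and>
        (A s t = 0 \<longleftrightarrow> A t s = 0))"

definition symmetrizable ::
  "('a, 'b) monoid_scheme \<Rightarrow> 'a set \<Rightarrow> ('a \<Rightarrow> 'a \<Rightarrow> real) \<Rightarrow> bool" where
  "symmetrizable G S A \<longleftrightarrow>
     (\<exists>\<delta> :: 'a \<Rightarrow> real.
        (\<forall>s\<in>S. \<delta> s > 0) \<and>
        (\<forall>s\<in>S. \<forall>t\<in>S. \<delta> s * A s t = \<delta> t * A t s) \<and>
        (\<forall>s\<in>S. \<forall>t\<in>S. conjugate_in G s t \<longrightarrow> \<delta> s = \<delta> t))"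

text \<open>
  \<open>V\<close> is the type \<open>'v\<close>, with basis \<open>\<alpha> s\<close> for \<open>s \<in> S\<close>; \<open>\<rho>\<close> is the linear action of \<open>G\<close>
  on \<open>V\<close>, which is determined by the formula for the generators.
\<close>

locale reflection_representation = coxeter_system G S m
  for G :: "('a, 'b) monoid_scheme" (structure) and S m +
  fixes A :: "'a \<Rightarrow> 'a \<Rightarrow> real"
    and \<alpha> :: "'a \<Rightarrow> 'v::real_vector"
    and \<rho> :: "'a \<Rightarrow> 'v \<Rightarrow> 'v"
  assumes cartan: "generalized_cartan_matrix S m A"
    and symmetrizable: "symmetrizable G S A"
    and basis_inj: "inj_on \<alpha> S"
    and basis_independent: "independent (\<alpha> ` S)"
    and basis_span: "span (\<alpha> ` S) = UNIV"
    and action_linear: "w \<in> carrier G \<Longrightarrow> linear (\<rho> w)"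
    and action_one: "\<rho> \<one> = id"
    and action_mult: "\<lbrakk>w \<in> carrier G; w' \<in> carrier G\<rbrakk> \<Longrightarrow> \<rho> (w \<otimes> w') = \<rho> w \<circ> \<rho> w'"
    and action_simple: "\<lbrakk>s \<in> S; t \<in> S\<rbrakk> \<Longrightarrow> \<rho> s (\<alpha> t) = \<alpha> t - A s t *\<^sub>R \<alpha> s"

definition dual_action ::
  "('a, 'b) monoid_scheme \<Rightarrow> ('a \<Rightarrow> 'v \<Rightarrow> 'v) \<Rightarrow> 'a \<Rightarrow> ('v \<Rightarrow> real) \<Rightarrow> 'v \<Rightarrow> real" where
  "dual_action G \<rho> w f = (\<lambda>x. f (\<rho> (inv\<^bsub>G\<^esub> w) x))"

text \<open>The dual space \<open>V\<^sup>*\<close> is the set of linear functionals on \<open>'v\<close>.\<close>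

definition Fix ::
  "('a, 'b) monoid_scheme \<Rightarrow> ('a \<Rightarrow> 'v::real_vector \<Rightarrow> 'v) \<Rightarrow> 'a \<Rightarrow> ('v \<Rightarrow> real) set" where
  "Fix G \<rho> w = {f. linear f \<and> dual_action G \<rho> w f = f}"

definition Stab ::
  "('a, 'b) monoid_scheme \<Rightarrow> ('a \<Rightarrow> 'v::real_vector \<Rightarrow> 'v) \<Rightarrow> ('v \<Rightarrow> real) set \<Rightarrow> 'a set" where
  "Stab G \<rho> U = {w \<in> carrier G. \<forall>f\<in>U. dual_action G \<rho> w f = f}"

end

theory Submission
  imports Defs
begin

text \<open>
  Everything is read off inversion sets, realised as sets of positive roots. For a sortable \<open>v\<close>
  the skew form \<open>\<omega>\<^sub>c\<close> of Reading and Speyer is nonnegative on each pair of roots taken in the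
  order of the reflection sequence. This property passes to \<open>s v\<close> (rotating an initial letter
  \<open>s\<close> of \<open>c\<close> to the end) and to the parabolic component obtained by dropping \<open>s\<close>, so
  induction shows that the inversion sets of two sortable elements \<open>v\<close>, \<open>v'\<close> intersect in the
  inversion set of some \<open>u\<close>. If \<open>cov v = cov v'\<close>, then all cover reflections of \<open>v\<close> are
  inversions of \<open>u\<close>, and an element below \<open>v\<close> inverting all cover reflections of \<open>v\<close> is \<open>v\<close>.

  The cover reflections of \<open>v\<close> are the conjugates by \<open>v\<close> of the right descents, which generate
  a finite parabolic subgroup. Averaging over it shows that a functional fixed by \<open>nc v\<close>
  vanishes on every root of \<open>cov v\<close>. A reflection lies in the stabilizer of this fixed space iff
  its root lies in the span of the roots of \<open>cov v\<close>, and \<open>cov v\<close> is recovered from these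
  reflections as the set of extremal positive roots.
\<close>

section \<open>Coxeter groups: words, lengths, dihedral factors\<close>

text \<open>The group may be infinite and the invariant form degenerate or indefinite, so finiteness
  has to come from inversion sets. In general the intersection of two inversion sets is not an
  inversion set: if \<open>s\<close> and \<open>t\<close> generate a dihedral group of order 6, then
  \<open>s t\<close> and \<open>t s\<close> share only the inversion \<open>s t s\<close>, which is
  no inversion set. The inequality for the skew form is what makes the intersection one. The second
  obstacle is duality. In V a product of distinct simple reflections fixes only the common fixed
  vectors, because simple roots are independent; in V* the functionals \<open>pairing s\<close> may
  be dependent, and the same argument breaks down. Finiteness of the parabolic subgroup generated by
  the descents takes the place of a positive definite form there. Finally, the Cartan entries are
  real and the matrix need not be symmetric, so that a reflection has only one positive root has to
  be derived from the constancy of \<delta> on conjugate generators.\<close>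

lemma word_prod_Nil [simp]: "word_prod G [] = \<one>\<^bsub>G\<^esub>"
  by (simp add: word_prod_def)

lemma word_prod_Cons [simp]: "word_prod G (a # x) = a \<otimes>\<^bsub>G\<^esub> word_prod G x"
  by (simp add: word_prod_def)

text \<open>The last letter is \<open>t\<close> whatever the length; the first one depends on
  parity. Suffixes are again alternating words with the same last letter, which suits right
  multiplication.\<close>

primrec alternating_word :: "nat \<Rightarrow> 'a \<Rightarrow> 'a \<Rightarrow> 'a list" where
  "alternating_word 0 s t = []"
| "alternating_word (Suc n) s t = alternating_word n t s @ [t]"

lemma length_alternating_word [simp]: "length (alternating_word n s t) = n"
  by (induction n arbitrary: s t) auto

lemma set_alternating_word: "set (alternating_word n s t) \<subseteq> {s, t}"
  by (induction n arbitrary: s t) auto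

text \<open>Splits the relator \<open>(s t)^n\<close> in the middle, so that a Coxeter relation
  becomes the equality of two alternating words.\<close>

lemma rev_alternating_word_append:
  "rev (alternating_word n t s) @ alternating_word n s t = concat (replicate n [s, t])"
proof (induction n arbitrary: s t)
  case (Suc n)
  have "[s] @ concat (replicate n [t, s]) @ [t] = concat (replicate (Suc n) [s, t])"
    by (induction n) auto
  moreover have "rev (alternating_word (Suc n) t s) @ alternating_word (Suc n) s t
      = [s] @ (rev (alternating_word n s t) @ alternating_word n t s) @ [t]"
    by simp
  ultimately show ?case using Suc[of s t] by (simp only: Suc)
qed simp

lemma alternating_word_take_last:
  "k \<le> n \<Longrightarrow> \<exists>y. alternating_word n s t = y @ alternating_word k s t \<and> length y = n - k
     \<and> set y \<subseteq> {s, t}"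
proof (induction k arbitrary: n s t)
  case 0
  then show ?case using set_alternating_word by fastforce
next
  case (Suc k)
  then obtain n' where n: "n = Suc n'" "k \<le> n'" by (cases n) auto
  from Suc.IH[OF n(2), of t s] n(1) show ?case by auto
qed

section \<open>Words, length and parity in a Coxeter group\<close>

context coxeter_system
begin

abbreviation "wp \<equiv> word_prod G"
abbreviation "len \<equiv> cox_length G S"

lemma gen_closed [simp, intro]: "s \<in> S \<Longrightarrow> s \<in> carrier G"
  using gens_closed by blast

lemma word_prod_closed [simp, intro]: "set x \<subseteq> S \<Longrightarrow> wp x \<in> carrier G"
  by (induction x) auto

lemma word_prod_carrier_closed: "set x \<subseteq> carrier G \<Longrightarrow> wp x \<in> carrier G"
  by (induction x) auto

lemma word_prod_append:
  "set x \<subseteq> carrier G \<Longrightarrow> set y \<subseteq> carrier G \<Longrightarrow> wp (x @ y) = wp x \<otimes> wp y"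
  by (induction x) (auto simp: word_prod_carrier_closed m_assoc)

lemma word_prod_append_gens: "set x \<subseteq> S \<Longrightarrow> set y \<subseteq> S \<Longrightarrow> wp (x @ y) = wp x \<otimes> wp y"
  using word_prod_append gens_closed by blast

lemma relation_prod:
  assumes "s \<in> S" "t \<in> S" "m s t = enat k"
  shows "wp (concat (replicate k [s, t])) = \<one>"
proof -
  have 1: "coxeter_cong S m ([] @ concat (replicate k [s, t]) @ []) ([] @ [])"
    by (rule coxeter_cong.relation) (use assms in auto)
  have "set (concat (replicate k [s, t])) \<subseteq> S" using assms by auto
  with 1 presentation[of "concat (replicate k [s, t])" "[]"] show ?thesis by simp
qed

lemma gen_square [simp]: "s \<in> S \<Longrightarrow> s \<otimes> s = \<one>"
  using relation_prod[of s s 1] matrix by (simp add: coxeter_matrix_def one_enat_def)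

lemma inv_gen [simp]: "s \<in> S \<Longrightarrow> inv s = s"
  by (simp add: inv_equality)

lemma mult_gen_gen [simp]: "w \<in> carrier G \<Longrightarrow> s \<in> S \<Longrightarrow> w \<otimes> s \<otimes> s = w"
  by (simp add: m_assoc)

lemma gen_mult_gen [simp]: "w \<in> carrier G \<Longrightarrow> s \<in> S \<Longrightarrow> s \<otimes> (s \<otimes> w) = w"
  by (simp flip: m_assoc)

lemma word_prod_rev: "set x \<subseteq> S \<Longrightarrow> wp (rev x) = inv (wp x)"
  by (induction x) (auto simp: word_prod_append_gens inv_mult_group)

text \<open>Every relator has even length, so the parity of a word is an invariant of its product.
  This excludes \<open>len (w \<otimes> s) = len w\<close>.\<close>

lemma coxeter_cong_parity: "coxeter_cong S m x y \<Longrightarrow> even (length x) = even (length y)"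
proof (induction rule: coxeter_cong.induct)
  case (relation s t k x y)
  have "even (length (concat (replicate k [s, t])))" by (induction k) auto
  then show ?case by simp
qed auto

lemma parity_word:
  "set x \<subseteq> S \<Longrightarrow> set y \<subseteq> S \<Longrightarrow> wp x = wp y \<Longrightarrow> even (length x) = even (length y)"
  using presentation coxeter_cong_parity by blast

lemma reduced_word_exists:
  assumes "w \<in> carrier G"
  shows "\<exists>x. reduced_word_for G S w x"
proof -
  let ?P = "\<lambda>k. \<exists>x. set x \<subseteq> S \<and> length x = k \<and> wp x = w"
  have "\<exists>k. ?P k" using generates[OF assms] by blast
  then have "?P (LEAST k. ?P k)" by (rule LeastI_ex)
  then show ?thesis unfolding reduced_word_for_def cox_length_def by auto
qed

lemma len_word_le: "set x \<subseteq> S \<Longrightarrow> len (wp x) \<le> length x"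
  unfolding cox_length_def by (rule Least_le) auto

lemma len_mult_gen_le:
  assumes "w \<in> carrier G" "s \<in> S"
  shows "len (w \<otimes> s) \<le> Suc (len w)"
proof -
  obtain x where x: "reduced_word_for G S w x" using reduced_word_exists assms by blast
  then show ?thesis using len_word_le[of "x @ [s]"] assms
    by (simp add: reduced_word_for_def word_prod_append_gens)
qed

lemma len_mult_gen_neq:
  assumes "w \<in> carrier G" "s \<in> S"
  shows "len (w \<otimes> s) \<noteq> len w"
proof
  assume eq: "len (w \<otimes> s) = len w"
  obtain x where x: "reduced_word_for G S w x" using reduced_word_exists assms by blast
  obtain y where y: "reduced_word_for G S (w \<otimes> s) y" using reduced_word_exists assms by blast
  have "even (length (x @ [s])) = even (length y)"
    by (rule parity_word) (use x y assms in \<open>auto simp: reduced_word_for_def word_prod_append_gens\<close>)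
  with x y eq show False by (auto simp: reduced_word_for_def)
qed

lemma len_mult_gen_cases:
  assumes "w \<in> carrier G" "s \<in> S"
  shows "len (w \<otimes> s) = Suc (len w) \<or> len w = Suc (len (w \<otimes> s))"
  using len_mult_gen_le[of w s] len_mult_gen_le[of "w \<otimes> s" s] len_mult_gen_neq[of w s] assms
  by (auto simp: le_Suc_eq)

lemma len_mult_word_le:
  assumes "w \<in> carrier G" "set z \<subseteq> S"
  shows "len (w \<otimes> wp z) \<le> len w + length z"
proof -
  obtain x where x: "reduced_word_for G S w x" using reduced_word_exists assms by blast
  then show ?thesis using len_word_le[of "x @ z"] assms
    by (simp add: reduced_word_for_def word_prod_append_gens)
qed

lemma len_one [simp]: "len \<one> = 0"
  using len_word_le[of "[]"] by simp

lemma right_descent_exists: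
  assumes "w \<in> carrier G" "w \<noteq> \<one>"
  shows "\<exists>s\<in>S. len (w \<otimes> s) < len w"
proof -
  obtain x where x: "reduced_word_for G S w x" using reduced_word_exists assms by blast
  with assms have "x \<noteq> []" by (auto simp: reduced_word_for_def)
  then obtain y s where y: "x = y @ [s]" by (metis rev_exhaust)
  then have yS: "set y \<subseteq> S" "s \<in> S" "w = wp y \<otimes> s" "len w = Suc (length y)"
    using x by (auto simp: reduced_word_for_def word_prod_append_gens)
  then have "w \<otimes> s = wp y" by simp
  then have "len (w \<otimes> s) < len w" using len_word_le[OF yS(1)] yS(4) by simp
  with yS(2) show ?thesis by blast
qed

lemma braid_relation:
  assumes "s \<in> S" "t \<in> S" "m s t = enat k"
  shows "wp (alternating_word k s t) = wp (alternating_word k t s)"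
proof -
  have a: "set (alternating_word k s t) \<subseteq> S" "set (alternating_word k t s) \<subseteq> S"
    using set_alternating_word assms by fastforce+
  have "inv (wp (alternating_word k t s)) \<otimes> wp (alternating_word k s t) = \<one>"
    using relation_prod[OF assms] a
    by (simp add: word_prod_rev word_prod_append_gens flip: rev_alternating_word_append)
  then show ?thesis using a by (metis inv_closed inv_equality inv_inv word_prod_closed)
qed

text \<open>
  The right factor in the dihedral group generated by \<open>s\<close> and \<open>t\<close> is taken of maximal length.
\<close>

lemma dihedral_factorization:
  assumes w: "w \<in> carrier G" and s: "s \<in> S" and t: "t \<in> S"
    and ws: "len w < len (w \<otimes> s)" and wt: "len (w \<otimes> t) < len w"
  obtains v n where "v \<in> carrier G" "w = v \<otimes> wp (alternating_word n s t)"
    "len v < len w" "len v < len (v \<otimes> s)" "len v < len (v \<otimes> t)" "enat n < m s t"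
proof -
  define P where "P n \<longleftrightarrow> (\<exists>v\<in>carrier G. \<exists>z. set z \<subseteq> {s, t} \<and> w = v \<otimes> wp z
    \<and> len w = len v + length z \<and> length z = n)" for n
  have st: "s \<noteq> t" using ws wt by auto
  have P1: "P 1"
    unfolding P_def using w t len_mult_gen_cases[OF w t] wt
    by (intro bexI[of _ "w \<otimes> t"] exI[of _ "[t]"]) auto
  have bound: "P n \<Longrightarrow> n \<le> len w" for n unfolding P_def by auto
  define n where "n = (GREATEST n. P n)"
  have Pn: "P n" and n_max: "\<And>k. P k \<Longrightarrow> k \<le> n"
    unfolding n_def using GreatestI_nat[of P] Greatest_le_nat[of P] P1 bound by blast+
  have "1 \<le> n" using n_max P1 .
  from Pn obtain v z where v: "v \<in> carrier G" and z: "set z \<subseteq> {s, t}"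
    and wvz: "w = v \<otimes> wp z" and lw: "len w = len v + length z" and n: "length z = n"
    unfolding P_def by auto
  have zS: "set z \<subseteq> S" using z s t by auto
  have step: "len v < len (v \<otimes> r)" if r: "r \<in> {s, t}" for r
  proof (rule ccontr)
    have rS: "r \<in> S" using r s t by auto
    assume "\<not> len v < len (v \<otimes> r)"
    then have "len v = Suc (len (v \<otimes> r))" using len_mult_gen_cases[OF v rS] by auto
    moreover have "w = (v \<otimes> r) \<otimes> wp (r # z)" using v zS rS wvz by (simp add: m_assoc)
    ultimately have "P (Suc n)" unfolding P_def using v rS r z lw n
      by (intro bexI[of _ "v \<otimes> r"] exI[of _ "r # z"]) auto
    then show False using n_max by fastforce
  qed
  have short: "length z \<le> length z'" if "set z' \<subseteq> S" "wp z' = wp z" for z'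
    using len_mult_word_le[OF v that(1)] that lw wvz by simp
  have alt: "y = alternating_word (length y) a b"
    if "{a, b} = {s, t}" "set y \<subseteq> {s, t}" "\<And>x c x'. y \<noteq> x @ [c, c] @ x'"
      "y = [] \<or> last y = b" for y a b
    using that
  proof (induction y arbitrary: a b rule: rev_induct)
    case (snoc c y)
    have cb: "c = b" using snoc.prems by simp
    have "y = alternating_word (length y) b a"
    proof (rule snoc.IH)
      show "y \<noteq> x @ [d, d] @ x'" for x d x'
        using snoc.prems(3)[of x d "x' @ [c]"] by auto
      show "y = [] \<or> last y = a"
      proof (cases "y = []")
        case False
        then obtain y' d where y': "y = y' @ [d]" by (metis rev_exhaust)
        then have "d \<noteq> b" using snoc.prems(3)[of y' b "[]"] cb by auto
        then have "d = a" using snoc.prems(1,2) y' by auto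
        with y' show ?thesis by simp
      qed simp
    qed (use snoc.prems in auto)
    with cb show ?case by simp
  qed simp
  have noss: "z \<noteq> x @ [c, c] @ x'" for x c x'
  proof
    assume zz: "z = x @ [c, c] @ x'"
    have "wp (x @ x') = wp z" using zS unfolding zz by (simp add: word_prod_append_gens)
    with short[of "x @ x'"] zS zz show False by auto
  qed
  \<comment> \<open>\<open>z\<close> cannot be rewritten at the same length so as to end in
    \<open>s\<close>: cancelling that letter would make \<open>w \<otimes> s\<close> shorter than
    \<open>w\<close>.\<close>
  have last_not_s: False if "set y \<subseteq> S" "wp (y @ [s]) = wp z" "length (y @ [s]) = length z" for y
  proof -
    have "w \<otimes> s = v \<otimes> wp y"
      using that(1) s v wvz by (simp add: word_prod_append_gens m_assoc flip: that(2))
    then have "len (w \<otimes> s) \<le> len v + length y" using len_mult_word_le v that(1) by simp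
    then show False using lw that(3) ws by simp
  qed
  have "last z = t"
  proof (rule ccontr)
    assume "last z \<noteq> t"
    moreover have "z \<noteq> []" using n \<open>1 \<le> n\<close> by auto
    ultimately have "last z = s" using z by (metis insertE last_in_set singletonD subset_iff)
    with \<open>z \<noteq> []\<close> last_not_s[of "butlast z"] zS show False
      by (metis append_butlast_last_id in_set_butlastD subset_iff)
  qed
  then have za: "z = alternating_word n s t" using alt[of s t z] z noss n by auto
  \<comment> \<open>Otherwise the braid relation turns the last \<open>m s t\<close> letters of
    \<open>z\<close> into an alternating word ending in \<open>s\<close>, against
    \<open>last_not_s\<close>.\<close>
  have "enat n < m s t"
  proof (rule ccontr)
    assume "\<not> enat n < m s t"
    then obtain k where k: "m s t = enat k" "k \<le> n" by (cases "m s t") auto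
    from matrix s t st have "2 \<le> m s t" by (auto simp: coxeter_matrix_def)
    then have "2 \<le> k" using k by (simp add: numeral_eq_enat)
    then obtain k' where k': "k = Suc k'" by (cases k) auto
    obtain y where y: "z = y @ alternating_word k s t" "set y \<subseteq> {s, t}"
      using alternating_word_take_last[OF k(2), of s t] unfolding za by blast
    have aS: "set (alternating_word j a b) \<subseteq> S" if "{a, b} = {s, t}" for j a b
      using set_alternating_word[of j a b] that s t by auto
    have "wp ((y @ alternating_word k' s t) @ [s]) = wp (y @ alternating_word k t s)"
      by (simp add: k')
    also have "\<dots> = wp z"
    proof -
      have "set y \<subseteq> S" using y s t by auto
      then show ?thesis
        using braid_relation[OF s t k(1)] aS[of s t k] aS[of t s k]
        by (simp add: y(1) word_prod_append_gens insert_commute)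
    qed
    finally show False
      using last_not_s[of "y @ alternating_word k' s t"] y s t aS[of s t k'] k' by auto
  qed
  moreover have "len v < len w" using lw n \<open>1 \<le> n\<close> by simp
  ultimately show ?thesis using that v wvz za step by blast
qed

end

section \<open>Positivity of roots\<close>

text \<open>The Chebyshev polynomial of the second kind of degree \<open>n - 1\<close> at
  \<open>l / 2\<close>: for \<open>l = 2 * cos \<theta>\<close> it is
  \<open>sin (n * \<theta>) / sin \<theta>\<close>. These are the coefficients of the roots in rank
  two.\<close>

fun chebyshev :: "real \<Rightarrow> nat \<Rightarrow> real" where
  "chebyshev l 0 = 0"
| "chebyshev l (Suc 0) = 1"
| "chebyshev l (Suc (Suc n)) = l * chebyshev l (Suc n) - chebyshev l n"

lemma sin_chebyshev: "sin \<theta> * chebyshev (2 * cos \<theta>) n = sin (real n * \<theta>)"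
proof (induction "2 * cos \<theta>" n rule: chebyshev.induct)
  case (3 n)
  have e: "real (Suc (Suc n)) * \<theta> = real (Suc n) * \<theta> + \<theta>" "real n * \<theta> = real (Suc n) * \<theta> - \<theta>"
    by (auto simp: algebra_simps)
  have "sin \<theta> * chebyshev (2 * cos \<theta>) (Suc (Suc n))
      = 2 * cos \<theta> * sin (real (Suc n) * \<theta>) - sin (real n * \<theta>)"
    using 3 by (simp add: algebra_simps)
  also have "\<dots> = sin (real (Suc (Suc n)) * \<theta>)"
  proof -
    have "2 * cos \<theta> * sin y - sin (y - \<theta>) = sin (y + \<theta>)" for y
      by (simp add: sin_add sin_diff)
    then show ?thesis unfolding e .
  qed
  finally show ?case .
qed auto

lemma chebyshev_nonneg_le:
  assumes "n \<le> k" "2 \<le> k"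
  shows "0 \<le> chebyshev (2 * cos (pi / real k)) n"
proof -
  let ?\<theta> = "pi / real k"
  have s: "0 < sin ?\<theta>" using assms by (intro sin_gt_zero) (auto simp: field_simps)
  have "0 \<le> sin (real n * ?\<theta>)" using assms
    by (intro sin_ge_zero) (auto simp: field_simps)
  then show ?thesis using sin_chebyshev[of ?\<theta> n] s by (metis zero_le_mult_iff less_le_not_le)
qed

text \<open>The case of infinite \<open>m s t\<close>, where there is no angle: from
  \<open>l \<ge> 2\<close> the recursion yields growing values.\<close>

lemma chebyshev_mono_nonneg:
  "2 \<le> l \<Longrightarrow> 0 \<le> chebyshev l n \<and> chebyshev l n \<le> chebyshev l (Suc n)"
proof (induction n)
  case (Suc n)
  then have "2 * chebyshev l (Suc n) \<le> l * chebyshev l (Suc n)" by (intro mult_right_mono) auto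
  with Suc show ?case by auto
qed auto

text \<open>The symmetrizing function is fixed as a parameter, since both the symmetric form and the
  skew form are built from it.\<close>

locale finite_reflection_representation = reflection_representation G S m A \<alpha> \<rho>
  for G :: "('a, 'b) monoid_scheme" (structure) and S m A
    and \<alpha> :: "'a \<Rightarrow> 'v::real_vector" and \<rho> +
  fixes \<delta> :: "'a \<Rightarrow> real"
  assumes finite_gens: "finite S"
    and \<delta>_pos: "s \<in> S \<Longrightarrow> \<delta> s > 0"
    and \<delta>_sym: "s \<in> S \<Longrightarrow> t \<in> S \<Longrightarrow> \<delta> s * A s t = \<delta> t * A t s"
    and \<delta>_conj: "s \<in> S \<Longrightarrow> t \<in> S \<Longrightarrow> conjugate_in G s t \<Longrightarrow> \<delta> s = \<delta> t"
begin

section \<open>Coordinates, coroots and the invariant form\<close>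

definition coord :: "'a \<Rightarrow> 'v \<Rightarrow> real" where
  "coord s x = representation (\<alpha> ` S) x (\<alpha> s)"

lemma in_span_simple: "x \<in> span (\<alpha> ` S)"
  using basis_span by simp

lemma coord_add [simp]: "coord s (x + y) = coord s x + coord s y"
  and coord_diff [simp]: "coord s (x - y) = coord s x - coord s y"
  and coord_scale [simp]: "coord s (c *\<^sub>R x) = c * coord s x"
  and coord_minus [simp]: "coord s (- x) = - coord s x"
  and coord_zero [simp]: "coord s 0 = 0"
  by (simp_all add: coord_def in_span_simple basis_independent real_vector.representation_add
      real_vector.representation_diff real_vector.representation_scale
      real_vector.representation_neg real_vector.representation_zero)

lemma linear_coord: "linear (coord s)"
  by (rule linearI) auto

lemma coord_sum [simp]: "coord s (sum f I) = (\<Sum>i\<in>I. coord s (f i))"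
  using linear_sum[OF linear_coord] .

lemma coord_simple [simp]: "s \<in> S \<Longrightarrow> t \<in> S \<Longrightarrow> coord s (\<alpha> t) = (if s = t then 1 else 0)"
  using basis_inj by (auto simp: coord_def real_vector.representation_basis[OF basis_independent]
      dest: inj_onD)

lemma coord_expansion: "x = (\<Sum>s\<in>S. coord s x *\<^sub>R \<alpha> s)"
proof -
  have "x = (\<Sum>b\<in>\<alpha> ` S. representation (\<alpha> ` S) x b *\<^sub>R b)"
    using real_vector.sum_representation_eq[OF basis_independent in_span_simple]
      finite_gens by simp
  then show ?thesis by (simp add: sum.reindex[OF basis_inj] coord_def)
qed

lemma coord_ext: "(\<And>s. s \<in> S \<Longrightarrow> coord s x = coord s y) \<Longrightarrow> x = y"
  by (subst coord_expansion[of x], subst coord_expansion[of y]) simp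

lemma linear_eqI_simple:
  assumes "linear f" "linear g" "\<And>s. s \<in> S \<Longrightarrow> f (\<alpha> s) = g (\<alpha> s)"
  shows "f x = g x"
  by (rule real_vector.linear_eq_on_span[OF assms(1,2), of "\<alpha> ` S"]) (use assms basis_span in auto)

text \<open>The simple coroot of \<open>s\<close> as a functional on V.\<close>

definition pairing :: "'a \<Rightarrow> 'v \<Rightarrow> real" where
  "pairing s x = (\<Sum>t\<in>S. A s t * coord t x)"

lemma linear_pairing: "linear (pairing s)"
  by (rule linearI) (auto simp: pairing_def algebra_simps sum.distrib sum_distrib_left)

lemma sum_coord_simple: "t \<in> S \<Longrightarrow> (\<Sum>r\<in>S. f r * coord r (\<alpha> t)) = f t"
  using finite_gens by (simp add: sum.delta' if_distrib[of "\<lambda>x. _ * x"] cong: if_cong)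

lemma pairing_simple [simp]: "t \<in> S \<Longrightarrow> pairing s (\<alpha> t) = A s t"
  using sum_coord_simple[of t "A s"] unfolding pairing_def by simp

lemma A_diag [simp]: "s \<in> S \<Longrightarrow> A s s = 2"
  using cartan by (simp add: generalized_cartan_matrix_def)

lemma A_nonpos: "s \<in> S \<Longrightarrow> t \<in> S \<Longrightarrow> s \<noteq> t \<Longrightarrow> A s t \<le> 0"
  using cartan by (simp add: generalized_cartan_matrix_def)

lemma A_zero_iff: "s \<in> S \<Longrightarrow> t \<in> S \<Longrightarrow> A s t = 0 \<longleftrightarrow> A t s = 0"
  using cartan by (cases "s = t") (auto simp: generalized_cartan_matrix_def)

lemma linear_rho: "w \<in> carrier G \<Longrightarrow> linear (\<rho> w)"
  by (rule action_linear)

lemma rho_add [simp]: "w \<in> carrier G \<Longrightarrow> \<rho> w (x + y) = \<rho> w x + \<rho> w y"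
  and rho_diff [simp]: "w \<in> carrier G \<Longrightarrow> \<rho> w (x - y) = \<rho> w x - \<rho> w y"
  and rho_scale [simp]: "w \<in> carrier G \<Longrightarrow> \<rho> w (c *\<^sub>R x) = c *\<^sub>R \<rho> w x"
  and rho_minus [simp]: "w \<in> carrier G \<Longrightarrow> \<rho> w (- x) = - \<rho> w x"
  and rho_zero [simp]: "w \<in> carrier G \<Longrightarrow> \<rho> w 0 = 0"
  and rho_sum: "w \<in> carrier G \<Longrightarrow> \<rho> w (sum f I) = (\<Sum>i\<in>I. \<rho> w (f i))"
  using linear_rho[of w]
  by (simp_all add: linear_add linear_diff linear_cmul linear_neg linear_0 linear_sum)

lemma rho_one [simp]: "\<rho> \<one> x = x"
  by (simp add: action_one)

lemma rho_mult [simp]: "w \<in> carrier G \<Longrightarrow> w' \<in> carrier G \<Longrightarrow> \<rho> (w \<otimes> w') x = \<rho> w (\<rho> w' x)"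
  by (simp add: action_mult)

lemma rho_inv_left [simp]: "w \<in> carrier G \<Longrightarrow> \<rho> (inv w) (\<rho> w x) = x"
  and rho_inv_right [simp]: "w \<in> carrier G \<Longrightarrow> \<rho> w (\<rho> (inv w) x) = x"
  by (simp_all flip: rho_mult)

lemma rho_gen: "s \<in> S \<Longrightarrow> \<rho> s x = x - pairing s x *\<^sub>R \<alpha> s"
proof (rule linear_eqI_simple[of "\<rho> s" "\<lambda>x. x - pairing s x *\<^sub>R \<alpha> s"])
  show "linear (\<lambda>x. x - pairing s x *\<^sub>R \<alpha> s)"
    by (rule linearI) (auto simp: linear_add[OF linear_pairing] linear_cmul[OF linear_pairing]
        algebra_simps)
qed (auto simp: linear_rho action_simple)

lemma rho_gen_simple: "s \<in> S \<Longrightarrow> \<rho> s (\<alpha> s) = - \<alpha> s"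
  by (simp add: action_simple scaleR_2)

lemma rho_gen_gen [simp]: "s \<in> S \<Longrightarrow> \<rho> s (\<rho> s x) = x"
  by (simp flip: rho_mult)

lemma coord_rho_gen [simp]: "r \<in> S \<Longrightarrow> s \<in> S \<Longrightarrow> r \<noteq> s \<Longrightarrow> coord r (\<rho> s x) = coord r x"
  by (simp add: rho_gen)

lemma coord_rho_word:
  "set x \<subseteq> S \<Longrightarrow> r \<in> S \<Longrightarrow> r \<notin> set x \<Longrightarrow> coord r (\<rho> (wp x) v) = coord r v"
  by (induction x) auto

text \<open>The invariant symmetric form, with
  \<open>form (\<alpha> s) (\<alpha> t) = \<delta> s * A s t\<close>.\<close>

definition form :: "'v \<Rightarrow> 'v \<Rightarrow> real" where
  "form x y = (\<Sum>s\<in>S. \<delta> s * coord s x * pairing s y)"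

lemma form_add_left: "form (x + x') y = form x y + form x' y"
  and form_scale_left: "form (c *\<^sub>R x) y = c * form x y"
  by (simp_all add: form_def algebra_simps sum.distrib sum_distrib_left)

lemma form_commute: "form x y = form y x"
proof -
  have "form x y = (\<Sum>s\<in>S. \<Sum>t\<in>S. \<delta> s * A s t * coord s x * coord t y)" for x y
    unfolding form_def pairing_def by (simp add: sum_distrib_left mult_ac)
  note e = this
  have "form x y = (\<Sum>s\<in>S. \<Sum>t\<in>S. \<delta> t * A t s * coord s x * coord t y)"
    unfolding e by (auto intro!: sum.cong simp: \<delta>_sym)
  also have "\<dots> = form y x" unfolding e by (subst sum.swap) (simp add: mult_ac)
  finally show ?thesis .
qed

lemma form_simple_left: "s \<in> S \<Longrightarrow> form (\<alpha> s) y = \<delta> s * pairing s y"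
  using sum_coord_simple[of s "\<lambda>r. \<delta> r * pairing r y"] by (simp add: form_def mult_ac)

lemma form_rho_gen: "s \<in> S \<Longrightarrow> form (\<rho> s x) (\<rho> s y) = form x y"
proof -
  assume s: "s \<in> S"
  have lin: "form (x - c *\<^sub>R x') y = form x y - c * form x' y" for x x' y c
    using form_add_left[of x "(- c) *\<^sub>R x'" y] form_scale_left[of "- c" x' y] by simp
  have lin': "form y (x - c *\<^sub>R x') = form y x - c * form y x'" for x x' y c
    using lin form_commute by metis
  show ?thesis using s form_commute[of x "\<alpha> s"]
    by (simp add: rho_gen lin lin' form_simple_left)
qed

lemma form_rho: "w \<in> carrier G \<Longrightarrow> form (\<rho> w x) (\<rho> w y) = form x y"
proof -
  have "set z \<subseteq> S \<Longrightarrow> form (\<rho> (wp z) x) (\<rho> (wp z) y) = form x y" for z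
    by (induction z) (auto simp: form_rho_gen)
  then show "w \<in> carrier G \<Longrightarrow> ?thesis" using generates by blast
qed

section \<open>Nonnegative vectors and rank two computations\<close>

definition nonneg :: "'v \<Rightarrow> bool" where
  "nonneg x \<longleftrightarrow> (\<forall>s\<in>S. 0 \<le> coord s x)"

lemma nonneg_add: "nonneg x \<Longrightarrow> nonneg y \<Longrightarrow> nonneg (x + y)"
  and nonneg_scale: "0 \<le> c \<Longrightarrow> nonneg x \<Longrightarrow> nonneg (c *\<^sub>R x)"
  by (auto simp: nonneg_def)

lemma nonneg_sum: "(\<And>i. i \<in> I \<Longrightarrow> nonneg (f i)) \<Longrightarrow> nonneg (sum f I)"
  by (auto simp: nonneg_def intro!: sum_nonneg)

lemma nonneg_simple: "s \<in> S \<Longrightarrow> nonneg (\<alpha> s)"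
  by (auto simp: nonneg_def)

lemma nonneg_antisym: "nonneg x \<Longrightarrow> nonneg (- x) \<Longrightarrow> x = 0"
  by (rule coord_ext) (force simp: nonneg_def)

text \<open>The factor \<open>- A t s / l\<close> rescales \<open>\<alpha> t\<close> so that the
  rank two Cartan matrix becomes symmetric with off-diagonal entry \<open>- l\<close>; then the
  coefficients obey the Chebyshev recursion.\<close>

lemma dihedral_root:
  assumes "s \<in> S" "t \<in> S" "l * l = A s t * A t s" "0 < l"
  shows "\<rho> (wp (alternating_word n s t)) (\<alpha> s) =
    (if even n then chebyshev l (Suc n) *\<^sub>R \<alpha> s + (- A t s / l * chebyshev l n) *\<^sub>R \<alpha> t
     else chebyshev l n *\<^sub>R \<alpha> s + (- A t s / l * chebyshev l (Suc n)) *\<^sub>R \<alpha> t)"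
  using assms
proof (induction n arbitrary: s t rule: induct_nat_012)
  case 0
  then show ?case by simp
next
  case 1
  then show ?case by (simp add: action_simple)
next
  case (ge2 n)
  have S: "set (alternating_word k a b) \<subseteq> S" if "{a, b} = {s, t}" for k a b
    using set_alternating_word[of k a b] ge2.prems that by auto
  have At: "A t s = - l * (- A t s / l)" using ge2.prems by simp
  \<comment> \<open>The induction hypothesis for \<open>Suc n\<close> is applied with
    \<open>s\<close> and \<open>t\<close> exchanged, so the two rescaling factors have to be inverse
    to each other.\<close>
  have K: "(- A t s / l) * (- A s t / l) = 1"
  proof -
    have "(- A t s / l) * (- A s t / l) = (A s t * A t s) / (l * l)" by simp
    also have "\<dots> = 1" using ge2.prems(4) unfolding ge2.prems(3)[symmetric] by simp
    finally show ?thesis .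
  qed
  have "\<rho> (wp (alternating_word (Suc (Suc n)) s t)) (\<alpha> s) =
      \<rho> (wp (alternating_word (Suc n) t s)) (\<rho> t (\<alpha> s))"
    using S[of t s "Suc n"] ge2.prems by (simp add: word_prod_append_gens insert_commute)
  also have "\<rho> t (\<alpha> s) = \<alpha> s - A t s *\<^sub>R \<alpha> t"
    using ge2.prems by (simp add: action_simple)
  also have "\<rho> (wp (alternating_word (Suc n) t s)) (\<alpha> s - A t s *\<^sub>R \<alpha> t) =
      - \<rho> (wp (alternating_word n s t)) (\<alpha> s)
      - A t s *\<^sub>R \<rho> (wp (alternating_word (Suc n) t s)) (\<alpha> t)"
  proof -
    have "\<rho> (wp (alternating_word (Suc n) t s)) (\<alpha> s) = - \<rho> (wp (alternating_word n s t)) (\<alpha> s)"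
      using S[of s t n] ge2.prems by (simp add: word_prod_append_gens rho_gen_simple)
    then show ?thesis using S[of t s "Suc n"] by (simp add: insert_commute)
  qed
  also have "\<dots> = (if even n then chebyshev l (Suc (Suc (Suc n))) *\<^sub>R \<alpha> s
        + (- A t s / l * chebyshev l (Suc (Suc n))) *\<^sub>R \<alpha> t
     else chebyshev l (Suc (Suc n)) *\<^sub>R \<alpha> s
        + (- A t s / l * chebyshev l (Suc (Suc (Suc n)))) *\<^sub>R \<alpha> t)"
  proof -
    note 1 = ge2.IH(1)[OF ge2.prems]
    have 2: "l * l = A t s * A s t" using ge2.prems by (simp add: mult.commute)
    note 2 = ge2.IH(2)[OF ge2.prems(2,1) 2 ge2.prems(4)]
    define \<kappa> where "\<kappa> = - A t s / l"
    define \<mu> where "\<mu> = - A s t / l"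
    have e: "A t s = - l * \<kappa>" "\<kappa> * \<mu> = 1" using At K unfolding \<kappa>_def \<mu>_def by blast+
    then have e2: "\<kappa> * (\<mu> * x) = x" "\<mu> * (\<kappa> * x) = x" for x
      by (metis mult.assoc mult.commute mult_1)+
    show ?thesis unfolding 1 2 \<kappa>_def[symmetric] \<mu>_def[symmetric] e(1)
      by (auto intro!: coord_ext simp: algebra_simps e(2) e2)
  qed
  finally show ?case by simp
qed

lemma dihedral_nonneg:
  assumes s: "s \<in> S" and t: "t \<in> S" and st: "s \<noteq> t" and n: "enat n < m s t"
  shows "\<exists>p q. 0 \<le> p \<and> 0 \<le> q
    \<and> \<rho> (wp (alternating_word n s t)) (\<alpha> s) = p *\<^sub>R \<alpha> s + q *\<^sub>R \<alpha> t"
proof (cases "A s t = 0")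
  \<comment> \<open>Here \<open>l\<close> would be 0 and \<open>dihedral_root\<close> does not
    apply; but the cosine condition forces \<open>m s t \<le> 2\<close>, which leaves
    \<open>n = 0\<close> and \<open>n = 1\<close>.\<close>
  case True
  then have ts: "A t s = 0" using A_zero_iff s t by simp
  have "case m s t of enat k \<Rightarrow> A s t * A t s = 4 * (cos (pi / real k))\<^sup>2 | \<infinity> \<Rightarrow> A s t * A t s \<ge> 4"
    using cartan s t st by (simp add: generalized_cartan_matrix_def)
  then obtain k where k: "m s t = enat k" "cos (pi / real k) = 0"
    using True by (auto split: enat.splits)
  have "k \<le> 2"
  proof (rule ccontr)
    assume "\<not> k \<le> 2"
    then have "0 < cos (pi / real k)" by (intro cos_gt_zero) (auto simp: field_simps)
    with k show False by simp
  qed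
  then have "n = 0 \<or> n = 1" using n k by auto
  then show ?thesis
  proof
    assume "n = 0"
    then show ?thesis by (intro exI[of _ 1] exI[of _ 0]) auto
  next
    assume "n = 1"
    then show ?thesis using s t ts
      by (intro exI[of _ 1] exI[of _ 0]) (auto simp: action_simple)
  qed
next
  case False
  have A: "A s t < 0" "A t s < 0"
    using A_nonpos[OF s t st] A_nonpos[OF t s] st False A_zero_iff[OF s t] by auto
  define l where "l = sqrt (A s t * A t s)"
  have l: "l * l = A s t * A t s" "0 < l" 
    using mult_neg_neg[OF A] unfolding l_def by auto
  have m_cases: "case m s t of enat k \<Rightarrow> A s t * A t s = 4 * (cos (pi / real k))\<^sup>2 | \<infinity> \<Rightarrow> A s t * A t s \<ge> 4"
    using cartan s t st by (simp add: generalized_cartan_matrix_def)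
  have nn: "0 \<le> chebyshev l n \<and> 0 \<le> chebyshev l (Suc n)"
  proof (cases "m s t")
    case (enat k)
    have "2 \<le> m s t" using matrix s t st by (auto simp: coxeter_matrix_def)
    then have k2: "2 \<le> k" using enat by (simp add: numeral_eq_enat)
    have "0 \<le> pi / real k" "pi / real k \<le> pi / 2" using k2 by (auto simp: field_simps)
    then have "0 \<le> cos (pi / real k)" using pi_gt_zero by (intro cos_ge_zero) linarith+
    moreover have "A s t * A t s = (2 * cos (pi / real k))\<^sup>2"
      using m_cases enat by (simp add: power_mult_distrib)
    ultimately have "l = \<bar>2 * cos (pi / real k)\<bar>"
      unfolding l_def by (simp only: real_sqrt_abs)
    then have "l = 2 * cos (pi / real k)" using \<open>0 \<le> cos (pi / real k)\<close> by simp
    then show ?thesis using chebyshev_nonneg_le k2 n enat by auto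
  next
    case infinity
    then have "2\<^sup>2 \<le> A s t * A t s" using m_cases by simp
    then have "2 \<le> l" unfolding l_def using real_le_rsqrt by blast
    then show ?thesis using chebyshev_mono_nonneg[of l n] by linarith
  qed
  have q: "0 \<le> - A t s / l" using A l by (simp add: field_simps)
  then have "0 \<le> - A t s / l * chebyshev l k" if "0 \<le> chebyshev l k" for k
    using that by (rule mult_nonneg_nonneg)
  then show ?thesis
    using dihedral_root[OF s t l, of n] nn by (cases "even n") (simp_all only: if_True if_False, blast+)
qed

text \<open>Splitting off a maximal dihedral factor replaces \<open>\<alpha> s\<close> by a
  nonnegative combination of \<open>\<alpha> s\<close> and \<open>\<alpha> t\<close>, and the
  shorter factor \<open>v\<close> ascends at both \<open>s\<close> and \<open>t\<close>, so the
  induction hypothesis covers both terms.\<close>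

theorem len_less_imp_nonneg:
  assumes "w \<in> carrier G" "s \<in> S" "len w < len (w \<otimes> s)"
  shows "nonneg (\<rho> w (\<alpha> s))"
  using assms
proof (induction "len w" arbitrary: w s rule: less_induct)
  case less
  show ?case
  proof (cases "w = \<one>")
    case True
    then show ?thesis using less nonneg_simple by simp
  next
    case False
    then obtain t where t: "t \<in> S" "len (w \<otimes> t) < len w" using right_descent_exists less by blast
    obtain v n where vn: "v \<in> carrier G" "w = v \<otimes> wp (alternating_word n s t)"
      "len v < len w" "len v < len (v \<otimes> s)" "len v < len (v \<otimes> t)" "enat n < m s t"
      using dihedral_factorization[OF less.prems(1,2) t(1) less.prems(3) t(2)] .
    have st: "s \<noteq> t" using t(2) less.prems by auto
    obtain p q where pq: "0 \<le> p" "0 \<le> q"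
      "\<rho> (wp (alternating_word n s t)) (\<alpha> s) = p *\<^sub>R \<alpha> s + q *\<^sub>R \<alpha> t"
      using dihedral_nonneg[OF less.prems(2) t(1) st vn(6)] by blast
    have S: "set (alternating_word n s t) \<subseteq> S"
      using set_alternating_word[of n s t] less.prems(2) t(1) by auto
    have "\<rho> w (\<alpha> s) = p *\<^sub>R \<rho> v (\<alpha> s) + q *\<^sub>R \<rho> v (\<alpha> t)"
      using vn(1,2) S pq by simp
    then show ?thesis
      using less.hyps[OF vn(3) vn(1) less.prems(2) vn(4)] less.hyps[OF vn(3) vn(1) t(1) vn(5)] pq
      by (simp add: nonneg_add nonneg_scale)
  qed
qed

end

section \<open>Inversion sets as sets of positive roots\<close>

text \<open>The counterpart of \<open>reflection_sequence\<close> in V: each entry is the root of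
  the reflection at the same place.\<close>

primrec (in reflection_representation) rootseq :: "'a list \<Rightarrow> 'v list" where
  "rootseq [] = []"
| "rootseq (a # x) = \<alpha> a # map (\<rho> a) (rootseq x)"

context finite_reflection_representation
begin

section \<open>Roots, their signs and their reflections\<close>

definition is_root :: "'v \<Rightarrow> bool" where
  "is_root x \<longleftrightarrow> (\<exists>w\<in>carrier G. \<exists>s\<in>S. x = \<rho> w (\<alpha> s))"

lemma root_rho_simple [intro]: "w \<in> carrier G \<Longrightarrow> s \<in> S \<Longrightarrow> is_root (\<rho> w (\<alpha> s))"
  by (auto simp: is_root_def)

lemma root_simple [intro]: "s \<in> S \<Longrightarrow> is_root (\<alpha> s)"
  using root_rho_simple[of \<one> s] by simp

lemma root_rho: "is_root x \<Longrightarrow> w \<in> carrier G \<Longrightarrow> is_root (\<rho> w x)"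
  unfolding is_root_def by (metis m_closed rho_mult)

lemma root_minus: "is_root x \<Longrightarrow> is_root (- x)"
  unfolding is_root_def by (metis gen_closed m_closed rho_mult rho_minus rho_gen_simple)

lemma simple_nonzero: "s \<in> S \<Longrightarrow> \<alpha> s \<noteq> 0"
  using coord_simple[of s s] by fastforce

lemma root_nonzero: "is_root x \<Longrightarrow> x \<noteq> 0"
  unfolding is_root_def by (metis simple_nonzero rho_inv_left rho_zero inv_closed)

lemma len_greater_imp_nonneg:
  assumes "w \<in> carrier G" "s \<in> S" "len (w \<otimes> s) < len w"
  shows "nonneg (- \<rho> w (\<alpha> s))"
  using len_less_imp_nonneg[of "w \<otimes> s" s] assms by (simp add: rho_gen_simple)

lemma root_cases: "is_root x \<Longrightarrow> nonneg x \<or> nonneg (- x)"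
  unfolding is_root_def
  by (metis len_less_imp_nonneg len_greater_imp_nonneg len_mult_gen_neq linorder_neqE_nat)

lemma root_nonneg_exclusive: "is_root x \<Longrightarrow> nonneg x \<Longrightarrow> \<not> nonneg (- x)"
  using nonneg_antisym root_nonzero by blast

lemma len_less_iff:
  "w \<in> carrier G \<Longrightarrow> s \<in> S \<Longrightarrow> len (w \<otimes> s) < len w \<longleftrightarrow> nonneg (- \<rho> w (\<alpha> s))"
  by (metis len_less_imp_nonneg len_greater_imp_nonneg len_mult_gen_neq linorder_neqE_nat
      root_nonneg_exclusive root_rho_simple)

text \<open>A nontrivial element has a right descent and therefore makes a simple root
  negative.\<close>

lemma faithful_one:
  assumes "w \<in> carrier G" "\<And>x. \<rho> w x = x"
  shows "w = \<one>"
proof (rule ccontr)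
  assume "w \<noteq> \<one>"
  then obtain s where s: "s \<in> S" "len (w \<otimes> s) < len w" using right_descent_exists assms by blast
  then have "nonneg (- \<alpha> s)" using len_greater_imp_nonneg[OF assms(1) s] assms(2) by simp
  then show False using s nonneg_simple root_nonneg_exclusive root_simple by blast
qed

lemma faithful:
  assumes "u \<in> carrier G" "v \<in> carrier G" "\<And>x. \<rho> u x = \<rho> v x"
  shows "u = v"
proof -
  have "inv v \<otimes> u = \<one>" using assms by (intro faithful_one) auto
  then show ?thesis using assms by (metis inv_closed inv_equality inv_inv)
qed

lemma form_root: "w \<in> carrier G \<Longrightarrow> s \<in> S \<Longrightarrow> form (\<rho> w (\<alpha> s)) (\<rho> w (\<alpha> s)) = 2 * \<delta> s"
  by (simp add: form_rho form_simple_left)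

lemma rho_reflection:
  assumes "w \<in> carrier G" "s \<in> S" and b: "b = \<rho> w (\<alpha> s)"
  shows "\<rho> (w \<otimes> s \<otimes> inv w) x = x - (2 * form b x / form b b) *\<^sub>R b"
proof -
  have "pairing s (\<rho> (inv w) x) = form (\<alpha> s) (\<rho> (inv w) x) / \<delta> s"
    using assms \<delta>_pos[of s] by (simp add: form_simple_left)
  also have "form (\<alpha> s) (\<rho> (inv w) x) = form b x"
    using form_rho[of w "\<alpha> s" "\<rho> (inv w) x"] assms by simp
  also have "form b x / \<delta> s = 2 * form b x / form b b"
    using form_root assms by simp
  finally show ?thesis using assms by (simp add: rho_gen)
qed

text \<open>The formula for a reflection is unchanged when its root is rescaled, and the action is
  faithful.\<close>

lemma proportional_roots_reflection:
  assumes w: "w \<in> carrier G" "s \<in> S" "w' \<in> carrier G" "s' \<in> S"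
    and c: "\<rho> w (\<alpha> s) = c *\<^sub>R \<rho> w' (\<alpha> s')"
  shows "w \<otimes> s \<otimes> inv w = w' \<otimes> s' \<otimes> inv w'"
proof (rule faithful)
  fix x
  let ?b = "\<rho> w' (\<alpha> s')"
  have "c \<noteq> 0" using root_nonzero[OF root_rho_simple[OF w(1,2)]] c by auto
  have f: "form (c *\<^sub>R ?b) y = c * form ?b y" "form y (c *\<^sub>R ?b) = c * form y ?b" for y
    using form_scale_left form_commute by metis+
  show "\<rho> (w \<otimes> s \<otimes> inv w) x = \<rho> (w' \<otimes> s' \<otimes> inv w') x"
    unfolding rho_reflection[OF w(1,2) HOL.refl] rho_reflection[OF w(3,4) HOL.refl] c
    using \<open>c \<noteq> 0\<close> by (simp add: f)
qed (use w in auto)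

lemma reflection_eq_imp_proportional:
  assumes w: "w \<in> carrier G" "s \<in> S" "w' \<in> carrier G" "s' \<in> S"
    and t: "w \<otimes> s \<otimes> inv w = w' \<otimes> s' \<otimes> inv w'"
  shows "\<exists>c. \<rho> w (\<alpha> s) = c *\<^sub>R \<rho> w' (\<alpha> s')"
proof -
  let ?b = "\<rho> w (\<alpha> s)"
  let ?b' = "\<rho> w' (\<alpha> s')"
  have "\<rho> (w \<otimes> s \<otimes> inv w) ?b = - ?b" using w by (simp add: rho_gen_simple)
  then have "?b - (2 * form ?b' ?b / form ?b' ?b') *\<^sub>R ?b' = - ?b"
    unfolding t rho_reflection[OF w(3,4) HOL.refl] .
  then have "2 *\<^sub>R ?b = (2 * form ?b' ?b / form ?b' ?b') *\<^sub>R ?b'"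
    by (simp add: scaleR_2 algebra_simps add_eq_0_iff)
  then have "(1/2) *\<^sub>R (2 *\<^sub>R ?b) = (form ?b' ?b / form ?b' ?b') *\<^sub>R ?b'" by simp
  then show ?thesis by auto
qed

text \<open>Proportional roots have the same reflection, so they come from conjugate generators; as
  \<open>\<delta>\<close> agrees on these, the roots have the same positive norm and the factor is 1
  or -1. The sign is settled by nonnegativity.\<close>

lemma nonneg_proportional_roots:
  assumes "is_root x" "is_root y" "nonneg x" "nonneg y" "x = c *\<^sub>R y"
  shows "x = y"
proof -
  obtain w s w' s' where w: "w \<in> carrier G" "s \<in> S" "w' \<in> carrier G" "s' \<in> S"
    and x: "x = \<rho> w (\<alpha> s)" and y: "y = \<rho> w' (\<alpha> s')"
    using assms(1,2) unfolding is_root_def by blast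
  have e: "w \<otimes> s \<otimes> inv w = w' \<otimes> s' \<otimes> inv w'"
    using proportional_roots_reflection[OF w] assms(5) unfolding x y .
  have "conjugate_in G s s'" unfolding conjugate_in_def
  proof
    have "s' = inv w' \<otimes> (w' \<otimes> s' \<otimes> inv w') \<otimes> w'" using w by (simp add: m_assoc flip: m_assoc[of "inv w'" w'])
    also have "\<dots> = (inv w' \<otimes> w) \<otimes> s \<otimes> inv (inv w' \<otimes> w)"
      unfolding e[symmetric] using w by (simp add: m_assoc inv_mult_group)
    finally show "s' = (inv w' \<otimes> w) \<otimes> s \<otimes> inv (inv w' \<otimes> w)" .
  qed (use w in auto)
  then have "form x x = form y y" using \<delta>_conj w x y form_root by simp
  moreover have "form x x = c * c * form y y"
    using assms(5) form_scale_left form_commute by (metis mult.assoc)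
  moreover have "form y y > 0" using form_root w y \<delta>_pos by simp
  ultimately have "c * c = 1" by simp
  then have "c = 1 \<or> c = - 1" using square_eq_1_iff by blast
  moreover have "c \<noteq> - 1"
    using assms root_nonneg_exclusive[of y] by auto
  ultimately show ?thesis using assms(5) by auto
qed

lemma nonsimple_root_other_coord:
  assumes "is_root x" "nonneg x" "s \<in> S" "x \<noteq> \<alpha> s"
  shows "\<exists>r\<in>S. r \<noteq> s \<and> 0 < coord r x"
proof (rule ccontr)
  assume "\<not> ?thesis"
  then have "coord r x = 0" if "r \<in> S" "r \<noteq> s" for r
    using that assms(2) unfolding nonneg_def by force
  then have "x = coord s x *\<^sub>R \<alpha> s"
    by (intro coord_ext) (use assms in auto)
  then show False
    using nonneg_proportional_roots[of x "\<alpha> s"] assms nonneg_simple root_simple by blast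
qed

text \<open>\<open>s\<close> changes only the coordinate at \<open>s\<close>, so a positive
  coordinate elsewhere survives and decides the sign.\<close>

lemma gen_nonneg_root:
  assumes "is_root x" "nonneg x" "s \<in> S" "x \<noteq> \<alpha> s"
  shows "nonneg (\<rho> s x)"
proof -
  obtain r where r: "r \<in> S" "r \<noteq> s" "0 < coord r x"
    using nonsimple_root_other_coord assms by blast
  then have "coord r (- \<rho> s x) < 0" using assms(3) by simp
  then have "\<not> nonneg (- \<rho> s x)" using r(1) unfolding nonneg_def by force
  then show ?thesis using root_cases root_rho assms by blast
qed

text \<open>Coordinates away from \<open>s\<close> cannot cancel among nonnegative vectors: a simple
  root spans an extreme ray. This is how roots are recognised later, both in parabolic components
  and in \<open>cov_roots\<close>.\<close>

lemma simple_root_extremal: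
  assumes T: "finite T" "r \<in> T" and s: "s \<in> S" and sum: "\<alpha> s = (\<Sum>t\<in>T. k t *\<^sub>R g t)"
    and nn: "\<And>t. t \<in> T \<Longrightarrow> nonneg (k t *\<^sub>R g t)"
    and r: "0 < k r" "is_root (g r)" "nonneg (g r)"
  shows "g r = \<alpha> s"
proof (rule ccontr)
  assume "g r \<noteq> \<alpha> s"
  then obtain q where q: "q \<in> S" "q \<noteq> s" "0 < coord q (g r)"
    using nonsimple_root_other_coord[OF r(2,3) s] by blast
  have "coord q (\<alpha> s) = (\<Sum>t\<in>T. coord q (k t *\<^sub>R g t))" by (subst sum) simp
  moreover have "0 < (\<Sum>t\<in>T. coord q (k t *\<^sub>R g t))"
  proof (rule sum_pos2[OF T])
    show "0 < coord q (k r *\<^sub>R g r)" using q r by simp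
    show "0 \<le> coord q (k t *\<^sub>R g t)" if "t \<in> T" for t
      using nn[OF that] q(1) unfolding nonneg_def by blast
  qed
  ultimately show False using q s by simp
qed

section \<open>Inversion sets under multiplication by a generator\<close>

definition invroots :: "'a \<Rightarrow> 'v set" where
  "invroots w = {b. is_root b \<and> nonneg b \<and> nonneg (- \<rho> (inv w) b)}"

lemma invroots_one [simp]: "invroots \<one> = {}"
  using root_nonneg_exclusive by (auto simp: invroots_def)

lemma invroots_mult_gen:
  assumes w: "w \<in> carrier G" and s: "s \<in> S" and b: "nonneg (\<rho> w (\<alpha> s))"
  shows "invroots (w \<otimes> s) = insert (\<rho> w (\<alpha> s)) (invroots w)" "\<rho> w (\<alpha> s) \<notin> invroots w"
proof -
  have iw: "\<rho> (inv (w \<otimes> s)) x = \<rho> s (\<rho> (inv w) x)" for x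
    using w s by (simp add: inv_mult_group)
  show "\<rho> w (\<alpha> s) \<notin> invroots w"
    using w s root_nonneg_exclusive nonneg_simple by (auto simp: invroots_def)
  show "invroots (w \<otimes> s) = insert (\<rho> w (\<alpha> s)) (invroots w)"
  proof (intro equalityI subsetI)
    fix x assume "x \<in> invroots (w \<otimes> s)"
    then have x: "is_root x" "nonneg x" "nonneg (- \<rho> s (\<rho> (inv w) x))"
      by (auto simp: invroots_def iw)
    show "x \<in> insert (\<rho> w (\<alpha> s)) (invroots w)"
    proof (rule ccontr)
      assume n: "x \<notin> insert (\<rho> w (\<alpha> s)) (invroots w)"
      have r: "is_root (\<rho> (inv w) x)" using x w root_rho by simp
      have "nonneg (\<rho> (inv w) x)" using n x r root_cases by (auto simp: invroots_def)
      moreover have "\<rho> (inv w) x \<noteq> \<alpha> s" using n w by (metis insertI1 rho_inv_right)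
      ultimately show False
        using gen_nonneg_root[OF r _ s] root_nonneg_exclusive[OF root_rho[OF r]] x s by auto
    qed
  next
    fix x assume "x \<in> insert (\<rho> w (\<alpha> s)) (invroots w)"
    then show "x \<in> invroots (w \<otimes> s)"
    proof
      assume "x = \<rho> w (\<alpha> s)"
      then show ?thesis using w s b nonneg_simple
        by (auto simp: invroots_def iw rho_gen_simple simp del: rho_mult)
    next
      assume "x \<in> invroots w"
      then have x: "is_root x" "nonneg x" "nonneg (- \<rho> (inv w) x)" by (auto simp: invroots_def)
      have "- \<rho> (inv w) x \<noteq> \<alpha> s"
      proof
        assume "- \<rho> (inv w) x = \<alpha> s"
        then have "\<rho> w (\<alpha> s) = - x" using w by (metis rho_inv_right rho_minus)
        then show False using x b root_nonneg_exclusive by simp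
      qed
      then have "nonneg (\<rho> s (- \<rho> (inv w) x))"
        using x w s by (intro gen_nonneg_root) (auto intro: root_minus root_rho)
      then show ?thesis using x w s by (auto simp: invroots_def iw simp del: rho_mult)
    qed
  qed
qed

lemma invroots_gen_mult:
  assumes w: "w \<in> carrier G" and s: "s \<in> S" and b: "\<alpha> s \<notin> invroots w"
  shows "invroots (s \<otimes> w) = insert (\<alpha> s) (\<rho> s ` invroots w)"
proof -
  have iw: "\<rho> (inv (s \<otimes> w)) x = \<rho> (inv w) (\<rho> s x)" for x
    using w s by (simp add: inv_mult_group)
  show ?thesis
  proof (intro equalityI subsetI)
    fix x assume "x \<in> invroots (s \<otimes> w)"
    then have x: "is_root x" "nonneg x" "nonneg (- \<rho> (inv w) (\<rho> s x))"
      by (auto simp: invroots_def iw)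
    show "x \<in> insert (\<alpha> s) (\<rho> s ` invroots w)"
    proof (cases "x = \<alpha> s")
      case False
      then have "\<rho> s x \<in> invroots w"
        using x s gen_nonneg_root root_rho by (auto simp: invroots_def)
      then show ?thesis using s by (metis imageI insertI2 rho_gen_gen)
    qed simp
  next
    fix x assume "x \<in> insert (\<alpha> s) (\<rho> s ` invroots w)"
    then show "x \<in> invroots (s \<otimes> w)"
    proof
      assume "x = \<alpha> s"
      moreover have "nonneg (\<rho> (inv w) (\<alpha> s))"
        using b s w root_cases[OF root_rho[OF root_simple[OF s], of "inv w"]] nonneg_simple
        by (auto simp: invroots_def)
      ultimately show ?thesis using s w nonneg_simple
        by (auto simp: invroots_def iw rho_gen_simple simp del: rho_mult)
    next
      assume "x \<in> \<rho> s ` invroots w"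
      then obtain y where y: "x = \<rho> s y" "y \<in> invroots w" by blast
      moreover have "y \<noteq> \<alpha> s" using y b by auto
      ultimately show ?thesis using s gen_nonneg_root root_rho
        by (auto simp: invroots_def iw simp del: rho_mult)
    qed
  qed
qed

text \<open>
  A descent \<open>s\<close> of \<open>inv u \<otimes> v\<close> gives a lower cover of \<open>v\<close> whose inversion set still contains
  that of \<open>u\<close>.
\<close>

lemma descent_root_notin:
  assumes u: "u \<in> carrier G" and v: "v \<in> carrier G" and uv: "u \<noteq> v"
    and sub: "invroots u \<subseteq> invroots v"
  shows "\<exists>s\<in>S. nonneg (- \<rho> v (\<alpha> s)) \<and> - \<rho> v (\<alpha> s) \<notin> invroots u"
proof -
  have "inv u \<otimes> v \<noteq> \<one>" using u v uv by (metis inv_closed inv_equality inv_inv)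
  then obtain s where s: "s \<in> S" and "len (inv u \<otimes> v \<otimes> s) < len (inv u \<otimes> v)"
    using right_descent_exists u v by blast
  then have "nonneg (- \<rho> (inv u \<otimes> v) (\<alpha> s))"
    using len_greater_imp_nonneg u v by blast
  then have neg: "nonneg (- \<rho> (inv u) (\<rho> v (\<alpha> s)))" using u v by simp
  have r: "is_root (\<rho> v (\<alpha> s))" using v s by blast
  have r': "is_root (\<rho> (inv u) (\<rho> v (\<alpha> s)))" using root_rho r u by simp
  have "nonneg (- \<rho> v (\<alpha> s))"
  proof (rule ccontr)
    assume "\<not> nonneg (- \<rho> v (\<alpha> s))"
    then have "\<rho> v (\<alpha> s) \<in> invroots v" using root_cases r neg sub by (auto simp: invroots_def)
    then show False using v s nonneg_simple root_nonneg_exclusive by (auto simp: invroots_def)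
  qed
  moreover have "- \<rho> v (\<alpha> s) \<notin> invroots u"
    using neg root_nonneg_exclusive[OF r'] u by (auto simp: invroots_def)
  ultimately show ?thesis using s by blast
qed

lemma descent_root_in_invroots:
  "v \<in> carrier G \<Longrightarrow> s \<in> S \<Longrightarrow> nonneg (- \<rho> v (\<alpha> s)) \<Longrightarrow> - \<rho> v (\<alpha> s) \<in> invroots v"
  using nonneg_simple by (auto simp: invroots_def intro: root_minus)

lemma invroots_inj:
  "u \<in> carrier G \<Longrightarrow> v \<in> carrier G \<Longrightarrow> invroots u = invroots v \<Longrightarrow> u = v"
  using descent_root_notin descent_root_in_invroots by blast

section \<open>Root sequences of words\<close>

lemma length_rootseq [simp]: "length (rootseq x) = length x"
  by (induction x) auto

lemma rootseq_append:
  "set x \<subseteq> S \<Longrightarrow> set y \<subseteq> S \<Longrightarrow> rootseq (x @ y) = rootseq x @ map (\<rho> (wp x)) (rootseq y)"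
  by (induction x) (auto simp: action_one)

lemma rootseq_snoc:
  "set x \<subseteq> S \<Longrightarrow> a \<in> S \<Longrightarrow> rootseq (x @ [a]) = rootseq x @ [\<rho> (wp x) (\<alpha> a)]"
  using rootseq_append[of x "[a]"] by simp

lemma rootseq_root: "set x \<subseteq> S \<Longrightarrow> b \<in> set (rootseq x) \<Longrightarrow> is_root b"
  by (induction x arbitrary: b) (auto intro: root_rho)

text \<open>Nonnegativity of the root sequence serves as the criterion for reducedness: each letter
  is then an ascent and adds one new root.\<close>

lemma rootseq_nonneg_invroots:
  assumes "set x \<subseteq> S" "\<forall>b\<in>set (rootseq x). nonneg b"
  shows "set (rootseq x) = invroots (wp x) \<and> distinct (rootseq x)"
  using assms
proof (induction x rule: rev_induct)
  case (snoc a x)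
  then show ?case
    using invroots_mult_gen[of "wp x" a] by (simp add: rootseq_snoc word_prod_append_gens)
qed simp

lemma reduced_rootseq_nonneg:
  assumes "set x \<subseteq> S" "len (wp x) = length x"
  shows "\<forall>b\<in>set (rootseq x). nonneg b"
  using assms
proof (induction x rule: rev_induct)
  case (snoc a x)
  then have x: "set x \<subseteq> S" "a \<in> S" "len (wp x \<otimes> a) = Suc (length x)"
    by (auto simp: word_prod_append_gens)
  then have l: "len (wp x) = length x"
    using len_mult_gen_le[of "wp x" a] len_word_le[of x] by simp
  then have "nonneg (\<rho> (wp x) (\<alpha> a))" using len_less_imp_nonneg x by simp
  then show ?case using snoc.IH x l by (simp add: rootseq_snoc)
qed simp

lemma finite_invroots: "w \<in> carrier G \<Longrightarrow> finite (invroots w)"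
  using reduced_word_exists[of w] rootseq_nonneg_invroots reduced_rootseq_nonneg
  unfolding reduced_word_for_def by (metis List.finite_set)

section \<open>The skew form and aligned words\<close>

text \<open>Minus the value of \<open>form\<close> on two simple roots, hence symmetric, and
  nonnegative off the diagonal.\<close>

definition weight :: "'a \<Rightarrow> 'a \<Rightarrow> real" where
  "weight s r = - \<delta> s * A s r"

lemma weight_sym: "s \<in> S \<Longrightarrow> r \<in> S \<Longrightarrow> weight s r = weight r s"
  by (simp add: weight_def \<delta>_sym)

lemma weight_nonneg: "s \<in> S \<Longrightarrow> r \<in> S \<Longrightarrow> s \<noteq> r \<Longrightarrow> 0 \<le> weight s r"
  using \<delta>_pos[of s] A_nonpos[of s r] by (simp add: weight_def mult_nonneg_nonpos)

text \<open>The share of the pairs in which \<open>s\<close> is the earlier letter, kept separate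
  because only this share changes when \<open>s\<close> is moved to the end or applied to both
  arguments.\<close>

definition omega_part :: "'a \<Rightarrow> 'a list \<Rightarrow> 'v \<Rightarrow> 'v \<Rightarrow> real" where
  "omega_part s c x y =
     (\<Sum>r\<leftarrow>c. weight s r * (coord s x * coord r y - coord r x * coord s y))"

text \<open>
  The skew form of Reading and Speyer, up to the normalisation of the roots: on simple roots,
  \<open>\<omega>(\<alpha>\<^sub>s, \<alpha>\<^sub>r) = - \<delta>(s) a\<^sub>s\<^sub>r\<close> if \<open>s\<close> precedes \<open>r\<close> in the word.
\<close>

primrec omega :: "'a list \<Rightarrow> 'v \<Rightarrow> 'v \<Rightarrow> real" where
  "omega [] x y = 0"
| "omega (s # c) x y = omega c x y + omega_part s c x y"

lemma omega_part_Nil [simp]: "omega_part s [] x y = 0"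
  and omega_part_Cons: "omega_part s (r # c) x y =
     weight s r * (coord s x * coord r y - coord r x * coord s y) + omega_part s c x y"
  by (simp_all add: omega_part_def)

lemma omega_part_append: "omega_part s (c @ d) x y = omega_part s c x y + omega_part s d x y"
  by (simp add: omega_part_def)

lemma linear_omega_part_left: "linear (\<lambda>x. omega_part s c x y)"
  by (rule linearI; induction c) (auto simp: omega_part_Cons algebra_simps)

lemma linear_omega_left: "linear (\<lambda>x. omega c x y)"
  by (rule linearI; induction c)
    (auto simp: linear_add[OF linear_omega_part_left] linear_cmul[OF linear_omega_part_left]
      algebra_simps)

lemma omega_part_commute: "omega_part s c y x = - omega_part s c x y"
  by (induction c) (auto simp: omega_part_Cons algebra_simps)

lemma omega_commute: "omega c y x = - omega c x y"
  by (induction c) (auto simp: omega_part_commute[of _ _ y x])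

lemma omega_part_eq:
  "omega_part s c x y = coord s x * (\<Sum>r\<leftarrow>c. weight s r * coord r y)
     - coord s y * (\<Sum>r\<leftarrow>c. weight s r * coord r x)"
  by (induction c) (auto simp: omega_part_Cons algebra_simps)

text \<open>Put last instead of first, \<open>s\<close> follows all other letters, so its share
  enters with the opposite sign.\<close>

lemma omega_snoc:
  assumes "set c \<subseteq> S" "s \<in> S"
  shows "omega (c @ [s]) x y = omega c x y - omega_part s c x y"
  using assms
proof (induction c)
  case (Cons r c)
  then have "weight r s = weight s r" by (simp add: weight_sym)
  then have "weight r s * (coord r x * coord s y - coord s x * coord r y) =
      - (weight s r * (coord s x * coord r y - coord r x * coord s y))"
    by (simp add: algebra_simps)
  with Cons show ?case by (simp add: omega_part_append omega_part_Cons)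
qed simp

section \<open>Supports of vectors and rotation of the skew form\<close>

definition supported :: "'a set \<Rightarrow> 'v \<Rightarrow> bool" where
  "supported K x \<longleftrightarrow> (\<forall>s\<in>S - K. coord s x = 0)"

lemma supported_simple: "s \<in> S \<Longrightarrow> s \<in> K \<Longrightarrow> supported K (\<alpha> s)"
  by (auto simp: supported_def)

lemma supported_rho_gen: "s \<in> S \<Longrightarrow> s \<in> K \<Longrightarrow> supported K v \<Longrightarrow> supported K (\<rho> s v)"
  unfolding supported_def by (metis DiffD1 DiffD2 coord_rho_gen)

lemma supported_rootseq:
  "set x \<subseteq> S \<Longrightarrow> set x \<subseteq> K \<Longrightarrow> b \<in> set (rootseq x) \<Longrightarrow> supported K b"
  by (induction x arbitrary: b) (auto intro: supported_simple supported_rho_gen)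

lemma omega_Cons_supported:
  assumes "s \<in> S" "supported K x" "supported K y" "s \<notin> K"
  shows "omega (s # c) x y = omega c x y"
  using assms by (simp add: omega_part_eq supported_def)

lemma sum_list_coord_gen:
  assumes "set c \<subseteq> S" "s \<in> S" "s \<notin> set c"
  shows "(\<Sum>r\<leftarrow>c. f r * coord r (\<rho> s x)) = (\<Sum>r\<leftarrow>c. f r * coord r x)"
  using assms by (induction c) auto

text \<open>The factor \<open>\<delta> s\<close> turns Cartan entries into weights; the condition on
  the support lets the sum over \<open>S\<close> run over the letters of \<open>s # c\<close>
  only.\<close>

lemma coord_gen_self:
  assumes s: "s \<in> S" and c: "set c \<subseteq> S" "distinct (s # c)" and x: "supported (set (s # c)) x"
  shows "\<delta> s * coord s (\<rho> s x) = - \<delta> s * coord s x + (\<Sum>r\<leftarrow>c. weight s r * coord r x)"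
proof -
  have "pairing s x = (\<Sum>r\<in>set (s # c). A s r * coord r x)"
    unfolding pairing_def using s c x finite_gens
    by (intro sum.mono_neutral_right) (auto simp: supported_def)
  also have "\<dots> = 2 * coord s x + (\<Sum>r\<leftarrow>c. A s r * coord r x)"
    using c s by (simp add: sum_list_distinct_conv_sum_set)
  finally have p: "pairing s x = 2 * coord s x + (\<Sum>r\<leftarrow>c. A s r * coord r x)" .
  have "(\<Sum>r\<leftarrow>c. weight s r * coord r x) = - \<delta> s * (\<Sum>r\<leftarrow>c. A s r * coord r x)"
    by (induction c) (auto simp: weight_def algebra_simps)
  then show ?thesis using s by (simp add: rho_gen p algebra_simps)
qed

text \<open>\<open>omega_part\<close> is the determinant of the two functionals
  \<open>coord s\<close> and \<open>X\<close>. The generator fixes \<open>X\<close> and sends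
  \<open>coord s\<close> to \<open>- coord s + X / \<delta> s\<close>, a substitution of determinant
  -1.\<close>

lemma omega_part_gen:
  assumes s: "s \<in> S" and c: "set c \<subseteq> S" "distinct (s # c)"
    and x: "supported (set (s # c)) x" and y: "supported (set (s # c)) y"
  shows "omega_part s c (\<rho> s x) (\<rho> s y) = - omega_part s c x y"
proof -
  define X where "X v = (\<Sum>r\<leftarrow>c. weight s r * coord r v)" for v
  have X: "X (\<rho> s v) = X v" for v
    unfolding X_def using c by (intro sum_list_coord_gen s) auto
  have op: "omega_part s c u v = coord s u * X v - coord s v * X u" for u v
    unfolding X_def by (rule omega_part_eq)
  have "\<delta> s * omega_part s c (\<rho> s x) (\<rho> s y)
      = (\<delta> s * coord s (\<rho> s x)) * X y - (\<delta> s * coord s (\<rho> s y)) * X x"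
    unfolding op X by (simp add: algebra_simps)
  also have "\<dots> = \<delta> s * (- omega_part s c x y)"
    unfolding coord_gen_self[OF s c x] coord_gen_self[OF s c y] X_def[symmetric] op
    by (simp add: algebra_simps)
  finally show ?thesis using \<delta>_pos[OF s] by (metis mult_left_cancel less_irrefl)
qed

lemma omega_gen_coord:
  assumes "set c \<subseteq> S" "s \<in> S" "s \<notin> set c"
  shows "omega c (\<rho> s x) (\<rho> s y) = omega c x y"
  using assms
proof (induction c)
  case (Cons r c)
  moreover from this have "r \<noteq> s" by auto
  ultimately show ?case using sum_list_coord_gen[of c s] by (simp add: omega_part_eq)
qed simp

text \<open>Conjugating a Coxeter element by its initial letter \<open>s\<close> transports the skew
  form by \<open>s\<close>. This invariance drives every induction that rotates the word.\<close>

lemma omega_rotate: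
  assumes s: "s \<in> S" and c: "set c \<subseteq> S" "distinct (s # c)"
    and x: "supported (set (s # c)) x" and y: "supported (set (s # c)) y"
  shows "omega (s # c) (\<rho> s x) (\<rho> s y) = omega (c @ [s]) x y"
  unfolding omega.simps(2) omega_part_gen[OF assms] omega_snoc[OF c(1) s]
  using omega_gen_coord[OF c(1) s] c(2) by simp

lemma omega_initial:
  assumes "s \<in> S" "set c \<subseteq> S" "s \<notin> set c"
  shows "omega (s # c) (\<alpha> s) y = (\<Sum>r\<leftarrow>c. weight s r * coord r y)"
proof -
  have 0: "(\<Sum>r\<leftarrow>d. f r * coord r (\<alpha> s)) = 0" if "set d \<subseteq> S" "s \<notin> set d" for f d
    using that assms(1) by (induction d) auto
  have "omega d (\<alpha> s) y = 0" if "set d \<subseteq> S" "s \<notin> set d" for d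
    using that
  proof (induction d)
    case (Cons r d)
    moreover from this have "r \<noteq> s" by auto
    ultimately show ?case using assms(1) 0[of d] by (simp add: omega_part_eq)
  qed simp
  then show ?thesis using assms 0[of c] by (simp add: omega_part_eq)
qed

lemma omega_initial_nonneg:
  assumes "s \<in> S" "set c \<subseteq> S" "s \<notin> set c" "nonneg y"
  shows "0 \<le> omega (s # c) (\<alpha> s) y"
  unfolding omega_initial[OF assms(1-3)]
proof (rule sum_list_nonneg)
  fix x assume "x \<in> set (map (\<lambda>r. weight s r * coord r y) c)"
  then obtain r where r: "x = weight s r * coord r y" "r \<in> set c" by auto
  then have "r \<in> S" "s \<noteq> r" using assms by auto
  then show "0 \<le> x" using r weight_nonneg[of s r] assms by (simp add: nonneg_def)
qed

text \<open>
  If \<open>\<omega>(\<alpha>\<^sub>s, b) = 0\<close>, then \<open>s\<close> is not joined to the rest of the support of \<open>b\<close>.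
\<close>

lemma omega_initial_zero:
  assumes s: "s \<in> S" and c: "set c \<subseteq> S" "distinct (s # c)"
    and b: "is_root b" "nonneg b" "supported (set (s # c)) b" "b \<noteq> \<alpha> s"
    and z: "omega (s # c) (\<alpha> s) b = 0"
  shows "coord s b = 0 \<and> \<rho> s b = b"
proof -
  have "(\<Sum>r\<leftarrow>c. weight s r * coord r b) = 0"
    using omega_initial[of s c b] s c z by simp
  then have "\<delta> s * coord s (\<rho> s b) = \<delta> s * (- coord s b)"
    using coord_gen_self[OF s c b(3)] by simp
  then have e: "coord s (\<rho> s b) = - coord s b"
    using \<delta>_pos[OF s] by (metis mult_left_cancel less_irrefl)
  have "nonneg (\<rho> s b)" using gen_nonneg_root b s by blast
  then have "coord s b = 0" using e b(2) s unfolding nonneg_def by force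
  moreover from this have "\<rho> s b = b" using e s by (intro coord_ext) (metis coord_rho_gen neg_0_equal_iff_equal)
  ultimately show ?thesis ..
qed

text \<open>
  Every sortable element has an aligned reduced word; unlike sorting words, aligned words are
  stable under restriction to parabolic subgroups.
\<close>

definition aligned :: "'a list \<Rightarrow> 'a list \<Rightarrow> bool" where
  "aligned c x \<longleftrightarrow> set x \<subseteq> set c \<and> (\<forall>b\<in>set (rootseq x). nonneg b)
     \<and> sorted_wrt (\<lambda>b b'. 0 \<le> omega c b b') (rootseq x)"

text \<open>A root before \<open>\<alpha> s\<close> has pairing \<ge> 0 with it in one order by
  alignment and in the other because \<open>s\<close> is initial, so the pairing is 0 and
  \<open>s\<close> fixes that root. Hence the letter producing \<open>\<alpha> s\<close> can be
  stripped off on the left as an \<open>s\<close> without disturbing the order of the other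
  roots.\<close>

lemma aligned_initial:
  assumes c: "set (s # c) \<subseteq> S" "distinct (s # c)" and x: "aligned (s # c) x"
    and b: "\<alpha> s \<in> set (rootseq x)"
  shows "\<exists>x'. aligned (c @ [s]) x' \<and> wp x = s \<otimes> wp x' \<and> length x = Suc (length x')"
proof -
  have s: "s \<in> S" and cS: "set c \<subseteq> S" and sc: "s \<notin> set c" using c by auto
  have xS: "set x \<subseteq> S" and xc: "set x \<subseteq> set (s # c)" using x c by (auto simp: aligned_def)
  obtain i where i: "i < length x" "rootseq x ! i = \<alpha> s"
    using b by (metis in_set_conv_nth length_rootseq)
  define y where "y = take i x"
  define a where "a = x ! i"
  define z where "z = drop (Suc i) x"
  have xe: "x = (y @ [a]) @ z" using i id_take_nth_drop[of i x] by (simp add: y_def a_def z_def)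
  then have S: "set y \<subseteq> S" "a \<in> S" "set z \<subseteq> S" using xS by auto
  have ly: "length y = i" using i by (simp add: y_def)
  have rs: "rootseq x = (rootseq y @ [\<rho> (wp y) (\<alpha> a)]) @ map (\<rho> (wp (y @ [a]))) (rootseq z)"
    unfolding xe using S by (simp add: rootseq_append rootseq_snoc action_one del: append_assoc)
  then have ya: "\<rho> (wp y) (\<alpha> a) = \<alpha> s" using i ly by (simp add: nth_append)
  \<comment> \<open>The reflection at place \<open>i\<close> is \<open>s\<close> itself, so deleting
    the letter \<open>a\<close> amounts to multiplying by \<open>s\<close> on the left.\<close>
  have "wp y \<otimes> a \<otimes> inv (wp y) = \<one> \<otimes> s \<otimes> inv \<one>"
    by (rule proportional_roots_reflection[where c = 1]) (use S s ya in auto)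
  then have comm: "wp y \<otimes> a = s \<otimes> wp y"
    using S s by (metis gen_closed inv_one inv_solve_right' l_one m_closed one_closed r_one word_prod_closed)
  define x' where "x' = y @ z"
  have wx: "wp x = s \<otimes> wp x'"
    unfolding xe x'_def using S s comm by (simp add: word_prod_append_gens m_assoc[symmetric])
  have fixy: "\<rho> s b = b" if "b \<in> set (rootseq y)" for b
  proof -
    have in_x: "b \<in> set (rootseq x)" using that rs by simp
    have nn: "nonneg b" using x in_x by (simp add: aligned_def)
    have "0 \<le> omega (s # c) b (\<alpha> s)"
      using x that unfolding aligned_def rs ya by (simp add: sorted_wrt_append)
    moreover have "0 \<le> omega (s # c) (\<alpha> s) b"
      using omega_initial_nonneg s cS sc nn by blast
    ultimately have 0: "omega (s # c) (\<alpha> s) b = 0"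
      using omega_commute[of "s # c" b "\<alpha> s"] by linarith
    have "distinct (rootseq x)"
      using rootseq_nonneg_invroots xS x by (simp add: aligned_def)
    then have "b \<noteq> \<alpha> s" using that unfolding rs ya by auto
    then show ?thesis
      using omega_initial_zero[OF s cS c(2) rootseq_root[OF xS in_x] nn _ _ 0]
        supported_rootseq[OF xS xc in_x] by blast
  qed
  have rx': "map (\<rho> s) (rootseq x') = rootseq y @ map (\<rho> (wp (y @ [a]))) (rootseq z)"
    unfolding x'_def using S s fixy comm
    by (auto simp: rootseq_append word_prod_append_gens simp flip: rho_mult intro!: map_idI)
  have rx: "rootseq x' = map (\<rho> s) (rootseq y @ map (\<rho> (wp (y @ [a]))) (rootseq z))"
    unfolding rx'[symmetric] using s by (simp add: comp_def)
  \<comment> \<open>\<open>\<alpha> s\<close> is the one positive root that \<open>s\<close> makes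
    negative; distinctness keeps it out of the remaining roots.\<close>
  have sub: "set (rootseq y @ map (\<rho> (wp (y @ [a]))) (rootseq z)) \<subseteq> set (rootseq x) - {\<alpha> s}"
  proof -
    have "distinct (rootseq x)"
      using rootseq_nonneg_invroots xS x by (simp add: aligned_def)
    then show ?thesis unfolding rs ya by (simp only: distinct_append set_append) auto
  qed
  have "aligned (c @ [s]) x'"
    unfolding aligned_def
  proof (intro conjI)
    show "set x' \<subseteq> set (c @ [s])" using xc unfolding xe x'_def by auto
    show "\<forall>b\<in>set (rootseq x'). nonneg b"
    proof
      fix b assume "b \<in> set (rootseq x')"
      then obtain b' where "b = \<rho> s b'" "b' \<in> set (rootseq x)" "b' \<noteq> \<alpha> s"
        using sub unfolding rx by auto
      then show "nonneg b"
        using gen_nonneg_root rootseq_root[OF xS] x s by (auto simp: aligned_def)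
    qed
    have sup: "supported (set (s # c)) b" if "b \<in> set (rootseq x')" for b
      using supported_rootseq[of x' "set (s # c)" b] that S xc unfolding xe x'_def by auto
    have "sorted_wrt (\<lambda>b b'. 0 \<le> omega (s # c) b b') (map (\<rho> s) (rootseq x'))"
      unfolding rx' using x unfolding aligned_def rs by (auto simp: sorted_wrt_append)
    then show "sorted_wrt (\<lambda>b b'. 0 \<le> omega (c @ [s]) b b') (rootseq x')"
      unfolding sorted_wrt_map
      by (rule sorted_wrt_mono_rel[rotated]) (use sup omega_rotate[OF s cS c(2)] in auto)
  qed
  moreover have "length x = Suc (length x')" unfolding xe x'_def by simp
  ultimately show ?thesis using wx by blast
qed

text \<open>
  The reason is that \<open>\<rho> (wp y) (\<alpha> s)\<close> is \<open>\<alpha> s\<close> plus a nonnegative combination of \<open>rootseq y\<close>.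
\<close>

lemma omega_rootseq_combination:
  assumes "set y \<subseteq> S" "s \<in> S" "s \<notin> set y" "\<forall>b\<in>set (rootseq y). 0 \<le> omega c b g"
  shows "omega c (\<alpha> s) g \<le> omega c (\<rho> (wp y) (\<alpha> s)) g"
  using assms
proof (induction y rule: rev_induct)
  case (snoc a y)
  have "\<rho> (wp (y @ [a])) (\<alpha> s) = \<rho> (wp y) (\<alpha> s) + (- A a s) *\<^sub>R \<rho> (wp y) (\<alpha> a)"
    using snoc.prems by (simp add: word_prod_append_gens action_simple)
  then have e: "omega c (\<rho> (wp (y @ [a])) (\<alpha> s)) g
      = omega c (\<rho> (wp y) (\<alpha> s)) g + (- A a s) * omega c (\<rho> (wp y) (\<alpha> a)) g"
    by (simp only: linear_add[OF linear_omega_left] linear_cmul[OF linear_omega_left] real_scaleR_def)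
  have "0 \<le> (- A a s) * omega c (\<rho> (wp y) (\<alpha> a)) g"
    using snoc.prems A_nonpos[of a s] by (intro mult_nonneg_nonneg) (auto simp: rootseq_snoc)
  then show ?case using snoc by (simp add: e rootseq_snoc)
qed simp

text \<open>At a first occurrence of the letter \<open>s\<close> the new root \<open>b\<close> has
  coordinate 1 at \<open>s\<close>. Yet \<omega>(\<open>\<alpha> s\<close>, \<open>b\<close>) \<le>
  \<omega>(\<open>b\<close>, \<open>b\<close>) = 0, and for \<open>b\<close> other than
  \<open>\<alpha> s\<close> this forces the coordinate to be 0.\<close>

lemma aligned_not_initial:
  assumes c: "set (s # c) \<subseteq> S" "distinct (s # c)" and x: "aligned (s # c) x"
    and b: "\<alpha> s \<notin> set (rootseq x)"
  shows "aligned c x"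
proof -
  have s: "s \<in> S" and cS: "set c \<subseteq> S" and sc: "s \<notin> set c" using c by auto
  have xS: "set x \<subseteq> S" and xc: "set x \<subseteq> set (s # c)" using x c by (auto simp: aligned_def)
  have "s \<notin> set x"
  proof
    assume "s \<in> set x"
    then obtain y z where xe: "x = (y @ [s]) @ z" and sy: "s \<notin> set y"
      by (auto dest: split_list_first)
    then have S: "set y \<subseteq> S" "set z \<subseteq> S" using xS by auto
    let ?b = "\<rho> (wp y) (\<alpha> s)"
    have rs: "rootseq x = (rootseq y @ [?b]) @ map (\<rho> (wp (y @ [s]))) (rootseq z)"
      unfolding xe using S s by (simp add: rootseq_append rootseq_snoc action_one del: append_assoc)
    then have bx: "?b \<in> set (rootseq x)" by simp
    then have nn: "nonneg ?b" using x by (simp add: aligned_def)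
    have "\<forall>g\<in>set (rootseq y). 0 \<le> omega (s # c) g ?b"
      using x unfolding aligned_def rs by (simp add: sorted_wrt_append)
    then have "omega (s # c) (\<alpha> s) ?b \<le> omega (s # c) ?b ?b"
      using omega_rootseq_combination S s sy by blast
    also have "\<dots> = 0" using omega_commute[of "s # c" ?b ?b] by linarith
    finally have "omega (s # c) (\<alpha> s) ?b = 0"
      using omega_initial_nonneg[OF s cS sc nn] by linarith
    moreover have "?b \<noteq> \<alpha> s" using b bx by auto
    ultimately have "coord s ?b = 0"
      using omega_initial_zero[OF s cS c(2) rootseq_root[OF xS bx] nn]
        supported_rootseq[OF xS xc bx] by blast
    moreover have "coord s ?b = 1" using S s sy by (simp add: coord_rho_word)
    ultimately show False by simp
  qed
  then have xc': "set x \<subseteq> set c" using xc by auto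
  have "sorted_wrt (\<lambda>b b'. 0 \<le> omega c b b') (rootseq x)"
  proof (rule sorted_wrt_mono_rel)
    show "sorted_wrt (\<lambda>b b'. 0 \<le> omega (s # c) b b') (rootseq x)"
      using x by (simp add: aligned_def)
    show "0 \<le> omega c b b'" if "b \<in> set (rootseq x)" "b' \<in> set (rootseq x)"
      "0 \<le> omega (s # c) b b'" for b b'
      using that omega_Cons_supported[of s "set c" b b' c] supported_rootseq[OF xS xc'] s sc by simp
  qed
  then show ?thesis using x xc' by (simp add: aligned_def)
qed

text \<open>
  Here \<open>wp z\<close> is the component of \<open>wp x\<close> in the parabolic subgroup generated by \<open>S - {s}\<close>.
\<close>

lemma parabolic_rootseq:
  assumes "set x \<subseteq> S" "\<forall>b\<in>set (rootseq x). nonneg b" "s \<in> S"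
  shows "\<exists>z. set z \<subseteq> set x - {s} \<and> rootseq z = filter (\<lambda>b. coord s b = 0) (rootseq x)"
  using assms(1,2)
proof (induction x rule: rev_induct)
  case Nil
  then show ?case by (intro exI[of _ "[]"]) simp
next
  case (snoc a x)
  have xS: "set x \<subseteq> S" "a \<in> S" using snoc.prems by auto
  have nnx: "\<forall>b\<in>set (rootseq x). nonneg b" and nna: "nonneg (\<rho> (wp x) (\<alpha> a))"
    using snoc.prems xS by (auto simp: rootseq_snoc)
  obtain z where z: "set z \<subseteq> set x - {s}" "rootseq z = filter (\<lambda>b. coord s b = 0) (rootseq x)"
    using snoc.IH[OF xS(1) nnx] by blast
  let ?b = "\<rho> (wp x) (\<alpha> a)"
  show ?case
  proof (cases "coord s ?b = 0")
    case False
    then show ?thesis using z xS by (intro exI[of _ z]) (auto simp: rootseq_snoc)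
  next
    case True
    have zS: "set z \<subseteq> S" "s \<notin> set z" using z xS by auto
    have nnz: "\<forall>b\<in>set (rootseq z). nonneg b" using nnx z by auto
    have Nx: "set (rootseq x) = invroots (wp x)" using rootseq_nonneg_invroots xS nnx by blast
    have Nz: "set (rootseq z) = invroots (wp z)" using rootseq_nonneg_invroots zS nnz by blast
    have wc: "wp x \<in> carrier G" "wp z \<in> carrier G" using xS zS by auto
    \<comment> \<open>\<open>d\<close> is the root that \<open>wp z\<close> carries to the new root.
      The aim is to show that it is simple, \<open>d = \<alpha> r\<close>, so that \<open>r\<close>
      is the letter to append to \<open>z\<close>.\<close>
    define d where "d = \<rho> (inv (wp z)) ?b"
    have dr: "is_root d" unfolding d_def using xS zS by (intro root_rho) auto
    have bz: "\<rho> (wp z) d = ?b" unfolding d_def using wc by simp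
    have cd: "coord s d = 0"
      using coord_rho_word[OF zS(1) assms(3) zS(2), of d] True bz by simp
    have "?b \<notin> invroots (wp x)" using invroots_mult_gen(2) wc xS nna by blast
    then have "?b \<notin> invroots (wp z)" using z Nx Nz by auto
    moreover have "is_root ?b" using wc xS by auto
    ultimately have nnd: "nonneg d"
      using nna root_cases[OF dr] unfolding invroots_def d_def by auto
    \<comment> \<open>\<open>wp x\<close> and \<open>wp z\<close> invert the same roots among those
      with coordinate 0 at \<open>s\<close>, so passing from one to the other keeps these simple
      roots nonnegative.\<close>
    have min: "nonneg (\<rho> (inv (wp x)) (\<rho> (wp z) (\<alpha> r)))" if r: "r \<in> S" "r \<noteq> s" for r
    proof -
      let ?g = "\<rho> (wp z) (\<alpha> r)"
      have g: "is_root ?g" "coord s ?g = 0"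
        using r wc zS assms(3) by (auto simp: coord_rho_word)
      then have g': "is_root (\<rho> (inv (wp x)) ?g)" using root_rho wc by simp
      show ?thesis
      proof (cases "nonneg ?g")
        case True
        have "?g \<notin> invroots (wp z)"
          using wc r nonneg_simple root_nonneg_exclusive by (auto simp: invroots_def)
        then have "?g \<notin> invroots (wp x)" using z Nx Nz g by auto
        then show ?thesis using root_cases[OF g'] True g by (auto simp: invroots_def)
      next
        case False
        then have "- ?g \<in> invroots (wp z)"
          using root_cases[OF g(1)] g root_minus wc r nonneg_simple by (auto simp: invroots_def)
        then have "- ?g \<in> invroots (wp x)" using z Nx Nz by auto
        then show ?thesis using wc by (simp add: invroots_def)
      qed
    qed
    have "\<exists>r\<in>S. r \<noteq> s \<and> coord r d \<noteq> 0"
      using root_nonzero[OF dr] coord_ext[of d 0] cd by fastforce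
    then obtain r where r: "r \<in> S" "r \<noteq> s" "0 < coord r d"
      using nnd unfolding nonneg_def by force
    let ?g = "\<lambda>t. \<rho> (inv (wp x)) (\<rho> (wp z) (\<alpha> t))"
    have "\<alpha> a = \<rho> (inv (wp x)) (\<rho> (wp z) d)" using bz wc by simp
    also have "\<dots> = (\<Sum>t\<in>S. coord t d *\<^sub>R ?g t)"
      by (subst coord_expansion[of d]) (use wc in \<open>simp add: rho_sum\<close>)
    finally have sum: "\<alpha> a = (\<Sum>t\<in>S. coord t d *\<^sub>R ?g t)" .
    have "?g r = \<alpha> a"
    proof (rule simple_root_extremal[OF finite_gens r(1) xS(2) sum _ r(3)])
      show "nonneg (coord t d *\<^sub>R ?g t)" if t: "t \<in> S" for t
      proof (cases "t = s")
        case True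
        then show ?thesis using cd by (simp add: nonneg_def)
      next
        case False
        then show ?thesis using t min nnd by (intro nonneg_scale) (auto simp: nonneg_def)
      qed
    qed (use r wc min in \<open>auto intro!: root_rho\<close>)
    then have br: "?b = \<rho> (wp z) (\<alpha> r)" using wc by (metis rho_inv_right)
    \<comment> \<open>Otherwise the two expressions for the new root would give it coordinates 0 and
      1 at \<open>r\<close>.\<close>
    have rx: "r \<in> set (x @ [a])"
    proof (rule ccontr)
      assume rx: "r \<notin> set (x @ [a])"
      then have "coord r ?b = 0" using r xS by (simp add: coord_rho_word)
      moreover have "coord r ?b = 1" unfolding br using rx r z zS by (subst coord_rho_word) auto
      ultimately show False by simp
    qed
    show ?thesis
      by (rule exI[of _ "z @ [r]"]) (use z zS r rx xS br True in \<open>auto simp: rootseq_snoc\<close>)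
  qed
qed

text \<open>A filtered sequence stays ordered, and the filter removes \<open>\<alpha> s\<close>,
  whose coordinate at \<open>s\<close> is 1.\<close>

lemma aligned_parabolic:
  assumes c: "set (s # c) \<subseteq> S" "distinct (s # c)" and x: "aligned (s # c) x"
  shows "\<exists>z. aligned c z \<and> rootseq z = filter (\<lambda>b. coord s b = 0) (rootseq x)"
proof -
  have xS: "set x \<subseteq> S" using x c by (auto simp: aligned_def)
  obtain z where z: "set z \<subseteq> set x - {s}"
    "rootseq z = filter (\<lambda>b. coord s b = 0) (rootseq x)"
    using parabolic_rootseq[of x s] xS x c by (auto simp: aligned_def)
  have zS: "set z \<subseteq> S" using z xS by auto
  have "aligned (s # c) z"
    using x z by (auto simp: aligned_def sorted_wrt_filter)
  moreover have "\<alpha> s \<notin> set (rootseq z)" using z c by auto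
  ultimately have "aligned c z" using aligned_not_initial c by blast
  with z show ?thesis by blast
qed

text \<open>
  The element \<open>u\<close> is the meet of \<open>wp x\<close> and \<open>wp y\<close> in the weak order.
\<close>

theorem aligned_meet:
  assumes "set c \<subseteq> S" "distinct c" "aligned c x" "aligned c y"
  shows "\<exists>u\<in>carrier G. invroots u = set (rootseq x) \<inter> set (rootseq y)"
  using assms
\<comment> \<open>Restriction to a parabolic subgroup shortens \<open>c\<close>, whereas rotation
  keeps the length of \<open>c\<close> and shortens both words.\<close>
proof (induction "length c + length x + length y" arbitrary: c x y rule: less_induct)
  case less
  show ?case
  proof (cases c)
    case Nil
    then have "x = []" using less.prems by (simp add: aligned_def)
    then show ?thesis by (intro bexI[of _ \<one>]) auto
  next
    case (Cons s d)
    have d: "set (s # d) \<subseteq> S" "distinct (s # d)" using less.prems Cons by auto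
    have s: "s \<in> S" using d by simp
    have al: "aligned (s # d) x" "aligned (s # d) y" using less.prems Cons by auto
    \<comment> \<open>If \<open>x'\<close> does not invert \<open>s\<close>, all its roots have
      coordinate 0 at \<open>s\<close>. The intersection is then unchanged when \<open>y'\<close> is
      replaced by its parabolic component.\<close>
    have reduce: "\<exists>u\<in>carrier G. invroots u = set (rootseq x') \<inter> set (rootseq y')"
      if x': "aligned (s # d) x'" and y': "aligned (s # d) y'"
        and nx: "\<alpha> s \<notin> set (rootseq x')"
        and l: "length x' + length y' \<le> length x + length y" for x' y'
    proof -
      have dx: "aligned d x'" using aligned_not_initial[OF d x' nx] .
      obtain z where z: "aligned d z" "rootseq z = filter (\<lambda>b. coord s b = 0) (rootseq y')"
        using aligned_parabolic[OF d y'] by blast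
      have "length z \<le> length y'" using z by (metis length_filter_le length_rootseq)
      then have "\<exists>u\<in>carrier G. invroots u = set (rootseq x') \<inter> set (rootseq z)"
        using less.hyps[of d x' z] l dx z d Cons by auto
      moreover have "coord s b = 0" if "b \<in> set (rootseq x')" for b
      proof -
        have "set x' \<subseteq> set d" using dx by (simp add: aligned_def)
        then have "supported (set d) b" using supported_rootseq[of x' "set d"] that d by auto
        then show ?thesis using d by (simp add: supported_def)
      qed
      ultimately show ?thesis using z by auto
    qed
    consider "\<alpha> s \<notin> set (rootseq x)" | "\<alpha> s \<notin> set (rootseq y)"
      | "\<alpha> s \<in> set (rootseq x)" "\<alpha> s \<in> set (rootseq y)" by blast
    then show ?thesis
    proof cases
      case 1
      then show ?thesis using reduce[of x y] al by simp
    next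
      case 2
      then show ?thesis using reduce[of y x] al by (simp add: Int_commute)
    next
      case 3
      obtain x' where x': "aligned (d @ [s]) x'" "wp x = s \<otimes> wp x'" "length x = Suc (length x')"
        using aligned_initial[OF d al(1) 3(1)] by blast
      obtain y' where y': "aligned (d @ [s]) y'" "wp y = s \<otimes> wp y'" "length y = Suc (length y')"
        using aligned_initial[OF d al(2) 3(2)] by blast
      have "\<exists>u\<in>carrier G. invroots u = set (rootseq x') \<inter> set (rootseq y')"
        by (rule less.hyps[of "d @ [s]"]) (use x' y' d Cons in auto)
      then obtain u where u: "u \<in> carrier G" "invroots u = set (rootseq x') \<inter> set (rootseq y')"
        by blast
      have N: "set (rootseq v) = insert (\<alpha> s) (\<rho> s ` set (rootseq v')) \<and> \<alpha> s \<notin> set (rootseq v')"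
        if v: "aligned (s # d) v" "aligned (d @ [s]) v'" "wp v = s \<otimes> wp v'" "\<alpha> s \<in> set (rootseq v)"
        for v v'
      proof -
        have S: "set v \<subseteq> S" "set v' \<subseteq> S" using v d by (auto simp: aligned_def)
        have e: "set (rootseq v) = invroots (wp v)"
          using rootseq_nonneg_invroots[OF S(1)] v(1) unfolding aligned_def by blast
        have e': "set (rootseq v') = invroots (wp v')"
          using rootseq_nonneg_invroots[OF S(2)] v(2) unfolding aligned_def by blast
        have c': "wp v' \<in> carrier G" using S by blast
        have "\<alpha> s \<in> invroots (s \<otimes> wp v')" using v(3,4) e by simp
        then have "nonneg (- \<rho> (inv (s \<otimes> wp v')) (\<alpha> s))" unfolding invroots_def by blast
        also have "- \<rho> (inv (s \<otimes> wp v')) (\<alpha> s) = \<rho> (inv (wp v')) (\<alpha> s)"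
          using c' s by (simp add: inv_mult_group rho_gen_simple)
        finally have "nonneg (\<rho> (inv (wp v')) (\<alpha> s))" .
        moreover have "is_root (\<rho> (inv (wp v')) (\<alpha> s))" using c' s by blast
        ultimately have "\<alpha> s \<notin> invroots (wp v')"
          using root_nonneg_exclusive unfolding invroots_def by blast
        then show ?thesis using invroots_gen_mult[OF c' s] v(3) unfolding e e' by simp
      qed
      note Nx = N[OF al(1) x'(1,2) 3(1)] and Ny = N[OF al(2) y'(1,2) 3(2)]
      have inj: "inj (\<rho> s)" using s by (metis injI rho_gen_gen)
      have "\<alpha> s \<notin> invroots u" unfolding u(2) using Nx by blast
      then have "invroots (s \<otimes> u) = insert (\<alpha> s) (\<rho> s ` invroots u)"
        by (rule invroots_gen_mult[OF u(1) s])
      also have "\<dots> = set (rootseq x) \<inter> set (rootseq y)"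
        unfolding u(2) image_Int[OF inj] conjunct1[OF Nx] conjunct1[OF Ny] by blast
      finally show ?thesis using u s by (intro bexI[of _ "s \<otimes> u"]) auto
    qed
  qed
qed

end

section \<open>Sorting words of sortable elements are aligned\<close>

lemma letter_at_Suc: "c \<noteq> [] \<Longrightarrow> letter_at c (Suc i) = letter_at (rotate1 c) i"
  by (simp add: letter_at_def nth_rotate1 mod_Suc_eq)

lemma letter_at_in_set: "c \<noteq> [] \<Longrightarrow> letter_at c i \<in> set c"
  by (simp add: letter_at_def)

lemma down_closed_mod:
  fixes i n :: nat
  assumes "\<forall>i\<in>P. n \<le> i \<longrightarrow> i - n \<in> P" "i \<in> P"
  shows "i mod n \<in> P"
  using assms(2)
proof (induction i rule: less_induct)
  case (less i)
  show ?case
  proof (cases "n \<le> i \<and> 0 < n")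
    case True
    then have "(i - n) mod n \<in> P" using less assms(1) by auto
    then show ?thesis using True by (simp add: le_mod_geq)
  qed (use less in auto)
qed

context coxeter_system
begin

lemma reduced_positions_exist:
  assumes "set c = S" "w \<in> carrier G"
  shows "\<exists>p. reduced_positions G S c w p"
proof -
  obtain x where x: "reduced_word_for G S w x" using reduced_word_exists assms by blast
  let ?n = "length c"
  have "\<exists>j<?n. c ! j = x ! k" if "k < length x" for k
    using that x assms(1) by (metis in_set_conv_nth nth_mem reduced_word_for_def subsetD)
  then obtain j where j: "\<And>k. k < length x \<Longrightarrow> j k < ?n \<and> c ! j k = x ! k" by metis
  \<comment> \<open>The \<open>k\<close>-th letter is taken from the \<open>k\<close>-th copy of
    \<open>c\<close>, which makes the positions increase.\<close>
  define p where "p = map (\<lambda>k. k * ?n + j k) [0..<length x]"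
  have "map (letter_at c) p = x"
    by (rule nth_equalityI) (auto simp: p_def letter_at_def dest: j)
  moreover have "sorted_wrt (<) p"
    unfolding p_def sorted_wrt_map
  proof (rule sorted_wrt_mono_rel[OF _ sorted_wrt_upt])
    fix a b assume a: "a \<in> set [0..<length x]" and ab: "a < b"
    have "a * ?n + j a < Suc a * ?n" using a j by simp
    also have "\<dots> \<le> b * ?n" using ab by (intro mult_le_mono1) simp
    finally show "a * ?n + j a < b * ?n + j b" by simp
  qed
  ultimately show ?thesis using x unfolding reduced_positions_def by blast
qed

text \<open>All candidates have length \<open>len w\<close>, so among them the lexicographic order
  agrees with the well-founded total order \<open>lenlex\<close>. A unique minimum exists and the
  definite description denotes it.\<close>

lemma sorting_positions_reduced:
  assumes "set c = S" "w \<in> carrier G"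
  shows "reduced_positions G S c w (sorting_positions G S c w)"
proof -
  let ?R = "reduced_positions G S c w"
  let ?P = "\<lambda>p. ?R p \<and> (\<forall>q. ?R q \<longrightarrow> q = p \<or> (p, q) \<in> lexord less_than)"
  obtain p0 where "?R p0" using reduced_positions_exist assms by blast
  then obtain p where p: "?R p" and min: "\<And>q. (q, p) \<in> lenlex less_than \<Longrightarrow> \<not> ?R q"
    using wfE_min[OF wf_lenlex[OF wf_less_than], of p0 "Collect ?R"] by auto
  have len: "length q = len w" if "?R q" for q
    using that by (auto simp: reduced_positions_def reduced_word_for_def)
  have P: "?P p"
  proof (intro conjI allI impI)
    fix q assume q: "?R q"
    have "total (lenlex less_than)" by (rule total_lenlex) (simp add: total_less_than)
    then have "q = p \<or> (p, q) \<in> lenlex less_than" using min q unfolding total_on_def by auto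
    then show "q = p \<or> (p, q) \<in> lexord less_than"
      using len p q by (auto simp: lenlex_conv lexord_lex)
  qed (rule p)
  have "\<exists>!p. ?P p"
  proof (rule ex1I[of ?P, OF P])
    fix q assume q: "?P q"
    have "asym less_than" by (simp add: asym_less_than)
    then show "q = p" using P q lexord_asymmetric by blast
  qed
  then have "?P (sorting_positions G S c w)"
    unfolding sorting_positions_def by (rule theI')
  then show ?thesis ..
qed

lemma reduced_word_Cons:
  assumes "s \<in> S" "set x \<subseteq> S" "len (wp (s # x)) = length (s # x)"
  shows "len (wp x) = length x"
proof -
  obtain y where y: "reduced_word_for G S (wp x) y" using reduced_word_exists assms by blast
  then have "len (wp (s # y)) \<le> length (s # y)"
    using assms by (intro len_word_le) (simp add: reduced_word_for_def)
  then have "length x \<le> len (wp x)" using y assms by (simp add: reduced_word_for_def)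
  then show ?thesis using len_word_le assms by (simp add: le_antisym)
qed

text \<open>A letter together with the number of its copy determines a position, because the letters
  of \<open>c\<close> are distinct. So inclusion of consecutive blocks becomes closure under moving
  one copy back.\<close>

lemma sortable_positions_down_closed:
  assumes c: "coxeter_word S c" and v: "v \<in> sortable G S c"
    and i: "i \<in> set (sorting_positions G S c v)" "length c \<le> i" "c \<noteq> []"
  shows "i - length c \<in> set (sorting_positions G S c v)"
proof -
  let ?n = "length c"
  have n: "0 < ?n" using i by simp
  then have "1 \<le> i div ?n" using i by (simp add: Suc_le_eq div_greater_zero_iff)
  then obtain j where j: "i div ?n = Suc j" by (metis Suc_le_D One_nat_def)
  then have "letter_at c i \<in> sorting_block G S c v (Suc j)" using i by (auto simp: sorting_block_def)
  then have "letter_at c i \<in> sorting_block G S c v j" using v by (auto simp: sortable_def)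
  then obtain i' where i': "i' \<in> set (sorting_positions G S c v)" "i' div ?n = j"
    "letter_at c i' = letter_at c i"
    by (auto simp: sorting_block_def)
  have "i' mod ?n = i mod ?n"
    using i'(3) n c unfolding letter_at_def coxeter_word_def
    by (subst (asm) nth_eq_iff_index_eq) auto
  then have "i = i' + ?n" using i'(2) j
    by (metis (no_types, lifting) add.commute add.left_commute div_mult_mod_eq mult_Suc)
  then show ?thesis using i' by simp
qed

end

context finite_reflection_representation
begin

lemma omega_snoc_eq_Cons:
  assumes "set c \<subseteq> S" "s \<in> S" "s \<notin> set c" "supported (set c) x" "supported (set c) y"
  shows "omega (c @ [s]) x y = omega (s # c) x y"
  using assms by (simp add: omega_snoc omega_part_eq supported_def)

text \<open>Phrased for position lists, because rotating \<open>c\<close> just lowers all positions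
  by one. Either position 0 is used and \<open>s\<close> is the first letter, or by closure
  \<open>s\<close> does not occur at all; both cases reduce to the rotated word.\<close>

lemma down_closed_word_aligned:
  assumes "set c \<subseteq> S" "distinct c" "c \<noteq> [] \<or> p = []" "sorted_wrt (<) p"
    and "\<forall>i\<in>set p. length c \<le> i \<longrightarrow> i - length c \<in> set p"
    and "len (wp (map (letter_at c) p)) = length p"
  shows "aligned c (map (letter_at c) p)"
  using assms
proof (induction "sum_list p + length p" arbitrary: c p rule: less_induct)
  case less
  show ?case
  proof (cases p)
    case Nil
    then show ?thesis by (simp add: aligned_def)
  next
    case (Cons k p')
    then obtain s d where c: "c = s # d" using less.prems(3) by (cases c) auto
    have s: "s \<in> S" "s \<notin> set d" and d: "set d \<subseteq> S" "distinct d"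
      using less.prems(1,2) c by auto
    have letS: "letter_at c i \<in> set c" for i using letter_at_in_set[of c i] c by blast
    let ?pred = "map (\<lambda>i. i - 1)"
    have word: "map (letter_at (d @ [s])) (?pred q) = map (letter_at c) q"
      if "0 \<notin> set q" for q
    proof -
      have "letter_at (d @ [s]) (i - 1) = letter_at c i" if "i \<in> set q" for i
        using letter_at_Suc[of c "i - 1"] that \<open>0 \<notin> set q\<close> c by (cases i) auto
      then show ?thesis by simp
    qed
    have IH: "aligned (d @ [s]) (map (letter_at c) q)"
      if q: "0 \<notin> set q" "set q = set p - {0}" "sorted_wrt (<) q"
        "len (wp (map (letter_at c) q)) = length q" "sum_list q \<le> sum_list p" "length q \<le> length p"
      for q
    proof -
      have "sum_list (?pred q) + length q = sum_list q" using q(1) by (induction q) auto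
      then have "sum_list (?pred q) + length (?pred q) < sum_list p + length p"
        using q(5,6) Cons by simp
      moreover have "sorted_wrt (<) (?pred q)"
        unfolding sorted_wrt_map using q(1,3)
        by (rule_tac sorted_wrt_mono_rel[OF _ q(3)]) (metis One_nat_def Suc_diff_1 Suc_mono diff_less_mono gr0I Suc_leI)
      moreover have "\<forall>i\<in>set (?pred q). length (d @ [s]) \<le> i \<longrightarrow> i - length (d @ [s]) \<in> set (?pred q)"
      proof (intro ballI impI)
        fix i assume "i \<in> set (?pred q)" and le: "length (d @ [s]) \<le> i"
        then obtain j where j: "j \<in> set q" "i = j - 1" by auto
        \<comment> \<open>\<open>j\<close> exceeds \<open>length c\<close> strictly, so the position
          one copy back is not the dropped position 0.\<close>
        then have "j - length c \<in> set p" "j - length c > 0"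
          using less.prems(5) q(2) le c by auto
        then have "j - length c \<in> set q" using q(2) by auto
        then have "j - length c - 1 \<in> set (?pred q)"
          unfolding set_map by (rule imageI)
        moreover have "j - length c - 1 = i - length (d @ [s])" using j c by simp
        ultimately show "i - length (d @ [s]) \<in> set (?pred q)" by simp
      qed
      moreover have "len (wp (map (letter_at (d @ [s])) (?pred q))) = length (?pred q)"
        using q(4) unfolding word[OF q(1)] by simp
      ultimately have "aligned (d @ [s]) (map (letter_at (d @ [s])) (?pred q))"
        using s d by (intro less.hyps) (simp_all only: set_append distinct_append, auto)
      then show ?thesis unfolding word[OF q(1)] .
    qed
    let ?x = "map (letter_at c) p"
    have xc: "set ?x \<subseteq> set c" and xS: "set ?x \<subseteq> S" using letS less.prems(1) by auto
    have nn: "\<forall>b\<in>set (rootseq ?x). nonneg b"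
      using reduced_rootseq_nonneg[OF xS] less.prems(6) by simp
    show ?thesis
    proof (cases "k = 0")
      case True
      let ?y = "map (letter_at c) p'"
      have x: "?x = s # ?y" using True Cons c by (simp add: letter_at_def)
      have yS: "set ?y \<subseteq> S" and yc: "set ?y \<subseteq> set (s # d)" using xS letS Cons c by auto
      have "len (wp ?y) = length p'"
        using reduced_word_Cons[OF s(1) yS] less.prems(6) Cons x by simp
      then have al: "aligned (d @ [s]) ?y"
        using less.prems(4) Cons True by (intro IH) auto
      have rs: "rootseq ?x = \<alpha> s # map (\<rho> s) (rootseq ?y)" using x by simp
      have "sorted_wrt (\<lambda>b b'. 0 \<le> omega (s # d) b b') (map (\<rho> s) (rootseq ?y))"
        unfolding sorted_wrt_map
      proof (rule sorted_wrt_mono_rel)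
        show "sorted_wrt (\<lambda>b b'. 0 \<le> omega (d @ [s]) b b') (rootseq ?y)"
          using al by (simp add: aligned_def)
        show "0 \<le> omega (s # d) (\<rho> s b) (\<rho> s b')"
          if "b \<in> set (rootseq ?y)" "b' \<in> set (rootseq ?y)" "0 \<le> omega (d @ [s]) b b'" for b b'
          using omega_rotate[OF s(1) d(1) _ supported_rootseq[OF yS yc] supported_rootseq[OF yS yc]]
            that s d by simp
      qed
      moreover have "\<forall>b\<in>set (map (\<rho> s) (rootseq ?y)). 0 \<le> omega (s # d) (\<alpha> s) b"
      proof
        fix b assume "b \<in> set (map (\<rho> s) (rootseq ?y))"
        then have "nonneg b" using nn unfolding rs by (metis list.set_intros(2))
        then show "0 \<le> omega (s # d) (\<alpha> s) b" by (rule omega_initial_nonneg[OF s(1) d(1) s(2)])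
      qed
      ultimately show ?thesis
        unfolding aligned_def using xc nn rs c by simp
    next
      case False
      then have 0: "0 \<notin> set p" using less.prems(4) Cons by auto
      have al: "aligned (d @ [s]) ?x"
        by (rule IH) (use 0 less.prems in auto)
      \<comment> \<open>Going back copy by copy, an occurrence of \<open>s\<close> would put
        position 0 into \<open>p\<close>.\<close>
      have "s \<notin> set ?x"
      proof
        assume "s \<in> set ?x"
        then obtain i where i: "i \<in> set p" "c ! (i mod length c) = c ! 0"
          using c by (auto simp: letter_at_def)
        then have "i mod length c = 0"
          using less.prems(2) c by (subst (asm) nth_eq_iff_index_eq) auto
        then show False using down_closed_mod[OF less.prems(5) i(1)] 0 by simp
      qed
      then have xd: "set ?x \<subseteq> set d" using xc unfolding c by (simp only: list.set(2)) blast
      have "sorted_wrt (\<lambda>b b'. 0 \<le> omega (s # d) b b') (rootseq ?x)"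
      proof (rule sorted_wrt_mono_rel)
        show "sorted_wrt (\<lambda>b b'. 0 \<le> omega (d @ [s]) b b') (rootseq ?x)"
          using al by (simp add: aligned_def)
        show "0 \<le> omega (s # d) b b'"
          if "b \<in> set (rootseq ?x)" "b' \<in> set (rootseq ?x)" "0 \<le> omega (d @ [s]) b b'" for b b'
          using omega_snoc_eq_Cons[OF d(1) s supported_rootseq[OF xS xd] supported_rootseq[OF xS xd]]
            that by simp
      qed
      then show ?thesis unfolding aligned_def using xc nn c by simp
    qed
  qed
qed

lemma sortable_sorting_word:
  assumes c: "coxeter_word S c" and v: "v \<in> sortable G S c"
  shows "aligned c (sorting_word G S c v)" "reduced_word_for G S v (sorting_word G S c v)"
proof -
  let ?p = "sorting_positions G S c v"
  have vG: "v \<in> carrier G" using v by (simp add: sortable_def)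
  have p: "reduced_positions G S c v ?p"
    using sorting_positions_reduced c vG by (simp add: coxeter_word_def)
  then show r: "reduced_word_for G S v (sorting_word G S c v)"
    by (simp add: reduced_positions_def sorting_word_def)
  have cp: "c \<noteq> [] \<or> ?p = []"
    using r c by (auto simp: reduced_word_for_def sorting_word_def coxeter_word_def)
  show "aligned c (sorting_word G S c v)"
    unfolding sorting_word_def
  proof (rule down_closed_word_aligned[OF _ _ cp])
    show "\<forall>i\<in>set ?p. length c \<le> i \<longrightarrow> i - length c \<in> set ?p"
    proof (cases "c = []")
      case True
      with cp show ?thesis by simp
    next
      case False
      then show ?thesis using sortable_positions_down_closed c v by blast
    qed
    show "len (wp (map (letter_at c) ?p)) = length ?p"
      using r by (simp add: reduced_word_for_def sorting_word_def)
  qed (use c p in \<open>auto simp: coxeter_word_def reduced_positions_def\<close>)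
qed

section \<open>Cover reflections and fixed spaces\<close>

definition cov_roots :: "'a \<Rightarrow> 'v set" where
  "cov_roots v = {- \<rho> v (\<alpha> s) | s. s \<in> S \<and> nonneg (- \<rho> v (\<alpha> s))}"

lemma cov_eq:
  assumes v: "v \<in> carrier G"
  shows "cov G S v = {v \<otimes> s \<otimes> inv v | s. s \<in> S \<and> nonneg (- \<rho> v (\<alpha> s))}"
proof (intro equalityI subsetI)
  fix t assume "t \<in> cov G S v"
  then obtain s where t: "t \<in> carrier G" "len (t \<otimes> v) < len v" and s: "s \<in> S" "t \<otimes> v = v \<otimes> s"
    by (auto simp: cov_def inversions_def reflections_def)
  then have "t = v \<otimes> s \<otimes> inv v" using v by (metis gen_closed inv_solve_right m_closed)
  then show "t \<in> {v \<otimes> s \<otimes> inv v | s. s \<in> S \<and> nonneg (- \<rho> v (\<alpha> s))}"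
    using t s v len_greater_imp_nonneg by auto
next
  fix t assume "t \<in> {v \<otimes> s \<otimes> inv v | s. s \<in> S \<and> nonneg (- \<rho> v (\<alpha> s))}"
  then obtain s where s: "s \<in> S" "nonneg (- \<rho> v (\<alpha> s))" and t: "t = v \<otimes> s \<otimes> inv v" by auto
  then have "t \<otimes> v = v \<otimes> s" using v by (simp add: m_assoc)
  then show "t \<in> cov G S v"
    using s v len_less_iff unfolding cov_def inversions_def reflections_def t by auto
qed

lemma cov_roots_mono:
  assumes v: "v \<in> carrier G" and v': "v' \<in> carrier G" and sub: "cov G S v \<subseteq> cov G S v'"
  shows "cov_roots v \<subseteq> cov_roots v'"
proof
  fix b assume "b \<in> cov_roots v"
  then obtain s where s: "s \<in> S" "nonneg b" and b: "b = - \<rho> v (\<alpha> s)" by (auto simp: cov_roots_def)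
  then have "v \<otimes> s \<otimes> inv v \<in> cov G S v'" using sub cov_eq[OF v] by blast
  then obtain s' where s': "s' \<in> S" "nonneg (- \<rho> v' (\<alpha> s'))"
    and e: "v \<otimes> s \<otimes> inv v = v' \<otimes> s' \<otimes> inv v'"
    unfolding cov_eq[OF v'] by blast
  obtain k where "\<rho> v (\<alpha> s) = k *\<^sub>R \<rho> v' (\<alpha> s')"
    using reflection_eq_imp_proportional[OF v s(1) v' s'(1) e] by blast
  then have "b = k *\<^sub>R - \<rho> v' (\<alpha> s')" using b by simp
  moreover have "is_root b" "is_root (- \<rho> v' (\<alpha> s'))"
    using b v v' s s' by (auto intro: root_minus)
  ultimately have "b = - \<rho> v' (\<alpha> s')"
    using nonneg_proportional_roots s(2) s'(2) by metis
  then show "b \<in> cov_roots v'" using s' by (auto simp: cov_roots_def)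
qed

theorem sortable_eqI:
  assumes c: "coxeter_word S c" and v: "v \<in> sortable G S c" "v' \<in> sortable G S c"
    and e: "cov_roots v = cov_roots v'"
  shows "v = v'"
proof -
  let ?x = "sorting_word G S c v" and ?x' = "sorting_word G S c v'"
  have cS: "set c \<subseteq> S" "distinct c" using c by (auto simp: coxeter_word_def)
  have vG: "v \<in> carrier G" "v' \<in> carrier G" using v by (auto simp: sortable_def)
  note w = sortable_sorting_word[OF c v(1)] and w' = sortable_sorting_word[OF c v(2)]
  have N: "set (rootseq ?x) = invroots v" "set (rootseq ?x') = invroots v'"
    using rootseq_nonneg_invroots[of ?x] rootseq_nonneg_invroots[of ?x'] w w'
    by (simp_all add: aligned_def reduced_word_for_def)
  obtain u where u: "u \<in> carrier G" "invroots u = invroots v \<inter> invroots v'"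
    using aligned_meet[OF cS w(1) w'(1)] N by auto
  have "cov_roots a \<subseteq> invroots a" if "a \<in> carrier G" for a
    using that descent_root_in_invroots by (auto simp: cov_roots_def)
  then have sub: "cov_roots v \<subseteq> invroots u" "cov_roots v' \<subseteq> invroots u"
    using vG(1,2) e unfolding u(2) by (simp_all only: Int_subset_iff) (metis+)
  \<comment> \<open>Otherwise \<open>descent_root_notin\<close> yields a descent of \<open>a\<close>
    whose root lies in \<open>cov_roots a\<close> but not in \<open>invroots u\<close>.\<close>
  have "u = a" if "a \<in> carrier G" "cov_roots a \<subseteq> invroots u" "invroots u \<subseteq> invroots a" for a
    using descent_root_notin[OF u(1) that(1)] that by (auto simp: cov_roots_def)
  then show ?thesis using sub vG u(2) by (metis Int_lower1 Int_lower2)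
qed

text \<open>As the letters are distinct, only \<open>a\<close> can change the coordinate at
  \<open>a\<close>. Comparing this coordinate on both sides shows that \<open>a\<close> alone fixes
  \<open>y\<close>, and the rest of the word follows by induction.\<close>

lemma fixed_word_gens:
  assumes "set x \<subseteq> S" "distinct x" "\<rho> (wp x) y = y" "r \<in> set x"
  shows "\<rho> r y = y"
  using assms
proof (induction x)
  case (Cons a x)
  have a: "a \<in> S" and xS: "set x \<subseteq> S" and ax: "a \<notin> set x" using Cons.prems by auto
  have "\<rho> a (\<rho> (wp x) y) = y" using Cons.prems(3) a xS by simp
  then have e: "\<rho> (wp x) y = \<rho> a y" using a by (metis rho_gen_gen)
  have "coord a (\<rho> a y) = coord a y" using coord_rho_word[OF xS a ax, of y] e by simp
  then have ay: "\<rho> a y = y" using a by (intro coord_ext) (metis coord_rho_gen)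
  then show ?case using Cons e xS by auto
qed simp

section \<open>Finite parabolic subgroups and invariant functionals\<close>

definition parabolic :: "'a set \<Rightarrow> 'a set" where
  "parabolic J = {wp x | x. set x \<subseteq> J}"

lemma parabolic_closed: "J \<subseteq> S \<Longrightarrow> u \<in> parabolic J \<Longrightarrow> u \<in> carrier G"
  by (auto simp: parabolic_def)

lemma parabolic_mult_gen: "J \<subseteq> S \<Longrightarrow> s \<in> J \<Longrightarrow> u \<in> parabolic J \<Longrightarrow> u \<otimes> s \<in> parabolic J"
  unfolding parabolic_def
proof clarify
  fix x assume "J \<subseteq> S" "s \<in> J" "set x \<subseteq> J"
  then have "wp (x @ [s]) = wp x \<otimes> s" "set (x @ [s]) \<subseteq> J"
    using word_prod_append_gens[of x "[s]"] by auto
  then show "\<exists>y. wp x \<otimes> s = wp y \<and> set y \<subseteq> J" by metis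
qed

text \<open>Coordinates outside \<open>J\<close> are not moved by \<open>u\<close>, so for an
  inverted root they are both \<ge> 0 and \<le> 0.\<close>

lemma invroots_parabolic_supported:
  assumes J: "J \<subseteq> S" and u: "u \<in> parabolic J" and b: "b \<in> invroots u"
  shows "supported J b"
  unfolding supported_def
proof
  fix r assume r: "r \<in> S - J"
  obtain x where x: "u = wp x" "set x \<subseteq> J" using u by (auto simp: parabolic_def)
  have "coord r (\<rho> (inv u) b) = coord r b"
    using x r J coord_rho_word[of "rev x" r b] by (auto simp: word_prod_rev)
  then show "coord r b = 0" using b r unfolding invroots_def nonneg_def by force
qed

text \<open>\<open>v\<close> makes every nonnegative combination of simple roots from
  \<open>J\<close> nonpositive. So all inversions of elements of \<open>parabolic J\<close> lie in
  the finite set \<open>invroots (inv v)\<close>, and an element is determined by its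
  inversions.\<close>

lemma finite_parabolic_descents:
  assumes v: "v \<in> carrier G" and J: "J = {s \<in> S. nonneg (- \<rho> v (\<alpha> s))}"
  shows "finite (parabolic J)"
proof -
  have JS: "J \<subseteq> S" using J by auto
  have "invroots u \<subseteq> invroots (inv v)" if u: "u \<in> parabolic J" for u
  proof
    fix b assume b: "b \<in> invroots u"
    then have s: "supported J b" using invroots_parabolic_supported JS u by blast
    have nn: "nonneg b" "is_root b" using b by (auto simp: invroots_def)
    have e: "- \<rho> v b = (\<Sum>s\<in>S. coord s b *\<^sub>R - \<rho> v (\<alpha> s))"
      by (subst (1) coord_expansion[of b]) (use v in \<open>simp add: rho_sum sum_negf\<close>)
    have "nonneg (coord s b *\<^sub>R - \<rho> v (\<alpha> s))" if "s \<in> S" for s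
    proof (cases "s \<in> J")
      case True
      then show ?thesis using nn that J by (intro nonneg_scale) (auto simp: nonneg_def)
    next
      case False
      then show ?thesis using s that by (simp add: supported_def nonneg_def)
    qed
    then have "nonneg (- \<rho> v b)" unfolding e by (rule nonneg_sum)
    then show "b \<in> invroots (inv v)" using nn v by (simp add: invroots_def)
  qed
  then have "invroots ` parabolic J \<subseteq> Pow (invroots (inv v))"
    by (intro image_subsetI PowI)
  then have "finite (invroots ` parabolic J)"
    by (rule finite_subset) (use finite_invroots v in simp)
  moreover have "inj_on invroots (parabolic J)"
  proof (rule inj_onI)
    fix u u' assume "u \<in> parabolic J" "u' \<in> parabolic J" "invroots u = invroots u'"
    then show "u = u'" using invroots_inj parabolic_closed[OF JS] by metis
  qed
  ultimately show ?thesis using finite_imageD by blast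
qed

text \<open>
  A vector fixed by a finite parabolic subgroup is a multiple of its average, and simple roots
  average to 0.
\<close>

lemma parabolic_fixed_zero:
  assumes J: "J \<subseteq> S" and fin: "finite (parabolic J)" and y: "supported J y"
    and fixed: "\<And>r. r \<in> J \<Longrightarrow> \<rho> r y = y"
  shows "y = 0"
proof -
  let ?W = "parabolic J"
  have W: "?W \<subseteq> carrier G" using parabolic_closed[OF J] by blast
  have zero: "(\<Sum>u\<in>?W. \<rho> u (\<alpha> s)) = 0" if s: "s \<in> J" for s
  proof -
    have sS: "s \<in> S" using s J by blast
    have "(\<Sum>u\<in>?W. \<rho> u (\<alpha> s)) = (\<Sum>u\<in>?W. \<rho> (u \<otimes> s) (\<alpha> s))"
      by (rule sum.reindex_bij_witness[of _ "\<lambda>u. u \<otimes> s" "\<lambda>u. u \<otimes> s"])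
        (use W sS s J parabolic_mult_gen[OF J s] in \<open>auto simp del: rho_mult\<close>)
    also have "\<dots> = (\<Sum>u\<in>?W. - \<rho> u (\<alpha> s))"
      using W sS by (intro sum.cong) (auto simp: rho_gen_simple)
    also have "\<dots> = - (\<Sum>u\<in>?W. \<rho> u (\<alpha> s))" by (rule sum_negf)
    finally show ?thesis
      by (metis add.inverse_neutral coord_ext coord_minus coord_zero equal_neg_zero)
  qed
  have "\<rho> (wp x) y = y" if "set x \<subseteq> J" for x
    using that J fixed by (induction x) (auto simp: subset_iff)
  then have "\<rho> u y = y" if "u \<in> ?W" for u using that by (auto simp: parabolic_def)
  then have "real (card ?W) *\<^sub>R y = (\<Sum>u\<in>?W. \<rho> u y)" by (simp add: scaleR_conv_of_real sum_constant_scaleR)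
  also have "\<dots> = (\<Sum>u\<in>?W. \<Sum>s\<in>S. coord s y *\<^sub>R \<rho> u (\<alpha> s))"
  proof (rule sum.cong)
    fix u assume "u \<in> ?W"
    then show "\<rho> u y = (\<Sum>s\<in>S. coord s y *\<^sub>R \<rho> u (\<alpha> s))"
      using W by (subst (1) coord_expansion[of y]) (auto simp: rho_sum)
  qed simp
  also have "\<dots> = (\<Sum>s\<in>S. coord s y *\<^sub>R (\<Sum>u\<in>?W. \<rho> u (\<alpha> s)))"
    by (subst sum.swap) (simp add: scaleR_sum_right)
  also have "\<dots> = 0"
    using zero y by (intro sum.neutral) (auto simp: supported_def)
  finally have "real (card ?W) *\<^sub>R y = 0" .
  moreover have "\<one> \<in> ?W" unfolding parabolic_def by (intro CollectI exI[of _ "[]"]) simp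
  then have "card ?W \<noteq> 0" using fin by auto
  ultimately show ?thesis by simp
qed

text \<open>Summing \<open>\<alpha> s\<close> over the powers of the product gives a vector fixed by
  the product, hence by every generator in \<open>J\<close>, hence 0. An invariant functional takes
  the same value on all \<open>N\<close> summands. This carries the fixed point argument from V over
  to V*.\<close>

lemma coxeter_invariant_functional_zero:
  assumes J: "J \<subseteq> S" and fin: "finite (parabolic J)" and x: "distinct x" "set x = J"
    and h: "linear h" "\<And>y. h (\<rho> (wp x) y) = h y" and s: "s \<in> J"
  shows "h (\<alpha> s) = (0 :: real)"
proof -
  \<comment> \<open>Powers of the product, written as words so that they visibly lie in
    \<open>parabolic J\<close>; finiteness then yields \<open>F N = \<one>\<close> for some
    \<open>N > 0\<close>.\<close>
  define F where "F n = wp (concat (replicate n x))" for n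
  have xS: "set x \<subseteq> S" using J x by simp
  have cS: "set (concat (replicate n x)) \<subseteq> S" for n using xS by auto
  have Fc: "F n \<in> carrier G" for n unfolding F_def using cS by blast
  have FSuc: "F (Suc n) = wp x \<otimes> F n" for n
    unfolding F_def using xS cS by (simp add: word_prod_append_gens)
  have Fadd: "F (i + j) = F i \<otimes> F j" for i j
    unfolding F_def using cS by (simp add: replicate_add word_prod_append_gens)
  have "F n \<in> parabolic J" for n
    unfolding F_def parabolic_def using x by (intro CollectI exI[of _ "concat (replicate n x)"]) auto
  then have "finite (range F)" using fin by (meson finite_subset image_subsetI)
  then have "\<not> inj F" using range_inj_infinite by blast
  then obtain i j where ij: "i < j" "F i = F j"
    unfolding inj_on_def by (metis linorder_neqE_nat)
  then obtain N where N: "j = i + N" "0 < N" using less_imp_add_positive by blast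
  then have "F i \<otimes> F N = F i" using ij Fadd by simp
  then have FN: "F N = \<one>" using Fc by simp
  have F0: "F 0 = \<one>" by (simp add: F_def)
  have sS: "s \<in> S" using s J by blast
  define y where "y = (\<Sum>k<N. \<rho> (F k) (\<alpha> s))"
  have "\<rho> (wp x) y = (\<Sum>k<N. \<rho> (F (Suc k)) (\<alpha> s))"
    unfolding y_def using xS Fc by (simp add: rho_sum FSuc)
  also have "\<dots> = y"
  proof -
    have "\<rho> (F 0) (\<alpha> s) + (\<Sum>k<N. \<rho> (F (Suc k)) (\<alpha> s)) = y + \<rho> (F N) (\<alpha> s)"
      unfolding y_def
      using sum.lessThan_Suc_shift[of "\<lambda>k. \<rho> (F k) (\<alpha> s)" N]
        sum.lessThan_Suc[of "\<lambda>k. \<rho> (F k) (\<alpha> s)" N]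
      by (simp only:)
    then show ?thesis by (simp add: FN F0)
  qed
  finally have "\<rho> r y = y" if "r \<in> J" for r
    using fixed_word_gens[OF xS x(1)] x(2) that by simp
  moreover have "supported J y"
    unfolding supported_def
  proof
    fix r assume r: "r \<in> S - J"
    have "coord r (\<rho> (F k) (\<alpha> s)) = 0" for k
      unfolding F_def using r cS x s sS by (subst coord_rho_word) auto
    then show "coord r y = 0" by (simp add: y_def)
  qed
  ultimately have "y = 0" using parabolic_fixed_zero J fin by blast
  moreover have "h (\<rho> (F k) z) = h z" for k z
  proof (induction k)
    case (Suc k)
    then show ?case using xS Fc h(2) by (simp add: FSuc)
  qed (simp add: F0)
  then have "h y = real N * h (\<alpha> s)"
    unfolding y_def by (simp add: linear_sum[OF h(1)])
  ultimately show ?thesis using linear_0[OF h(1)] N by simp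
qed

section \<open>Reflection sequences and the fixed space of \<open>nc\<close>\<close>

lemma rootseq_nth:
  assumes "set x \<subseteq> S" "i < length x"
  shows "rootseq x ! i = \<rho> (wp (take i x)) (\<alpha> (x ! i))"
proof -
  have x: "x = take i x @ x ! i # drop (Suc i) x" using assms id_take_nth_drop by blast
  have S: "set (take i x) \<subseteq> S" "set (x ! i # drop (Suc i) x) \<subseteq> S"
    using assms set_take_subset[of i x] set_drop_subset[of "Suc i" x] by auto
  have "rootseq x = rootseq (take i x) @ map (\<rho> (wp (take i x))) (rootseq (x ! i # drop (Suc i) x))"
    by (subst (1) x) (rule rootseq_append[OF S])
  then show ?thesis using assms by (simp add: nth_append)
qed

lemma reflection_sequence_nth:
  assumes "set x \<subseteq> S" "i < length x"
  shows "reflection_sequence G x ! i = wp (take i x) \<otimes> (x ! i) \<otimes> inv (wp (take i x))"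
proof -
  have "set (take i x) \<subseteq> S" "x ! i \<in> S"
    using assms set_take_subset[of i x] by auto
  then show ?thesis using assms
    by (simp add: reflection_sequence_def word_prod_append_gens word_prod_rev m_assoc)
qed

lemma distinct_reflection_sequence:
  assumes x: "set x \<subseteq> S" and nn: "\<forall>b\<in>set (rootseq x). nonneg b"
  shows "distinct (reflection_sequence G x)"
  unfolding distinct_conv_nth
proof (intro allI impI notI)
  have l: "length (reflection_sequence G x) = length x" by (simp add: reflection_sequence_def)
  fix i j assume "i < length (reflection_sequence G x)" "j < length (reflection_sequence G x)"
    and ij: "i \<noteq> j" and e: "reflection_sequence G x ! i = reflection_sequence G x ! j"
  then have i: "i < length x" and j: "j < length x" using l by auto
  have c: "wp (take k x) \<in> carrier G" "k < length x \<Longrightarrow> x ! k \<in> S" for k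
    using x set_take_subset[of k x] by (auto intro!: word_prod_closed)
  obtain k where "rootseq x ! i = k *\<^sub>R rootseq x ! j"
    using reflection_eq_imp_proportional[OF c(1) c(2)[OF i] c(1) c(2)[OF j]] e
    unfolding reflection_sequence_nth[OF x i] reflection_sequence_nth[OF x j]
      rootseq_nth[OF x i] rootseq_nth[OF x j] by blast
  moreover have m: "rootseq x ! i \<in> set (rootseq x)" "rootseq x ! j \<in> set (rootseq x)"
    using i j by auto
  ultimately have "rootseq x ! i = rootseq x ! j"
    using nonneg_proportional_roots rootseq_root[OF x] nn by blast
  then show False
    using rootseq_nonneg_invroots[OF x nn] ij i j by (simp add: nth_eq_iff_index_eq)
qed

lemma cov_in_reflection_sequence:
  assumes x: "set x \<subseteq> S" and nn: "\<forall>b\<in>set (rootseq x). nonneg b"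
  shows "cov G S (wp x) \<subseteq> set (reflection_sequence G x)"
proof
  fix t assume "t \<in> cov G S (wp x)"
  then obtain s where s: "s \<in> S" "nonneg (- \<rho> (wp x) (\<alpha> s))" and t: "t = wp x \<otimes> s \<otimes> inv (wp x)"
    using cov_eq[of "wp x"] x by auto
  have "- \<rho> (wp x) (\<alpha> s) \<in> set (rootseq x)"
    using descent_root_in_invroots[of "wp x" s] s x rootseq_nonneg_invroots[OF x nn] by auto
  then obtain i where i: "i < length x" "rootseq x ! i = - \<rho> (wp x) (\<alpha> s)"
    by (metis in_set_conv_nth length_rootseq)
  have "\<rho> (wp x) (\<alpha> s) = (- 1) *\<^sub>R \<rho> (wp (take i x)) (\<alpha> (x ! i))"
    using i rootseq_nth[OF x i(1)] by simp
  then have "t = reflection_sequence G x ! i"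
    unfolding t reflection_sequence_nth[OF x i(1)]
    by (rule proportional_roots_reflection[rotated 4])
      (use x s i set_take_subset[of i x] in \<open>auto intro!: word_prod_closed\<close>)
  then show "t \<in> set (reflection_sequence G x)"
    using i by (simp add: reflection_sequence_def)
qed

lemma word_prod_conj:
  assumes "v \<in> carrier G" "set x \<subseteq> S"
  shows "wp (map (\<lambda>s. v \<otimes> s \<otimes> inv v) x) = v \<otimes> wp x \<otimes> inv v"
  using assms(2)
proof (induction x)
  case (Cons a x)
  have "wp (map (\<lambda>s. v \<otimes> s \<otimes> inv v) (a # x)) = (v \<otimes> a \<otimes> inv v) \<otimes> (v \<otimes> wp x \<otimes> inv v)"
    using Cons by simp
  also have "\<dots> = v \<otimes> a \<otimes> (inv v \<otimes> v) \<otimes> wp x \<otimes> inv v"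
    using Cons.prems assms(1) by (simp only: m_assoc m_closed inv_closed gen_closed word_prod_closed set_simps insert_subset)
  also have "\<dots> = v \<otimes> wp (a # x) \<otimes> inv v"
    using Cons.prems assms(1) by (simp add: m_assoc)
  finally show ?case .
qed (use assms in simp)

definition annihilator :: "'v set \<Rightarrow> ('v \<Rightarrow> real) set" where
  "annihilator B = {f. linear f \<and> (\<forall>b\<in>B. f b = 0)}"

text \<open>Conjugation by \<open>v\<close> turns \<open>nc\<close> into a product of the right
  descents of \<open>v\<close>, each occurring once, that is, into a Coxeter element of a finite
  parabolic subgroup. Conversely, a functional vanishing on a root is fixed by its
  reflection.\<close>

theorem Fix_nc:
  assumes c: "coxeter_word S c" and v: "v \<in> sortable G S c"
  shows "Fix G \<rho> (nc G S c v) = annihilator (cov_roots v)"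
proof -
  let ?x = "sorting_word G S c v"
  have vG: "v \<in> carrier G" using v by (simp add: sortable_def)
  note w = sortable_sorting_word[OF c v]
  have x: "set ?x \<subseteq> S" "wp ?x = v" and nn: "\<forall>b\<in>set (rootseq ?x). nonneg b"
    using w by (auto simp: aligned_def reduced_word_for_def)
  define ts where "ts = filter (\<lambda>t. t \<in> cov G S v) (reflection_sequence G ?x)"
  have ts: "distinct ts" "set ts = cov G S v"
    unfolding ts_def using distinct_reflection_sequence[OF x(1) nn]
      cov_in_reflection_sequence[OF x(1) nn] x(2) by auto
  define J where "J = {s \<in> S. nonneg (- \<rho> v (\<alpha> s))}"
  have JS: "J \<subseteq> S" by (auto simp: J_def)
  let ?conj = "\<lambda>s. v \<otimes> s \<otimes> inv v"
  define js where "js = map (\<lambda>t. inv v \<otimes> t \<otimes> v) ts"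
  have cov: "cov G S v = ?conj ` J" unfolding cov_eq[OF vG] J_def by auto
  have conj_inv: "inv v \<otimes> ?conj s \<otimes> v = s" if "s \<in> J" for s
  proof -
    have "s \<in> carrier G" using that JS by blast
    then show ?thesis using vG by (simp add: m_assoc flip: m_assoc[of "inv v" v])
  qed
  have js: "set js = J" "map ?conj js = ts"
  proof -
    have "set js = (\<lambda>t. inv v \<otimes> t \<otimes> v) ` ?conj ` J" unfolding js_def by (simp add: ts cov)
    also have "\<dots> = J" using conj_inv by (force simp: image_image)
    finally show "set js = J" .
    have "?conj (inv v \<otimes> t \<otimes> v) = t" if "t \<in> set ts" for t
      using that conj_inv unfolding ts(2) cov by auto
    then show "map ?conj js = ts" unfolding js_def by (simp add: map_idI)
  qed
  have djs: "distinct js" using ts(1) js(2) by (metis distinct_map)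
  let ?g = "wp ts"
  have nc: "nc G S c v = ?g" by (simp add: nc_def ts_def)
  have g: "?g = v \<otimes> wp js \<otimes> inv v"
    using word_prod_conj[OF vG, of js] js JS by simp
  have jsS: "set js \<subseteq> S" using js JS by simp
  have gG: "?g \<in> carrier G" using g vG jsS by simp
  show ?thesis
  proof (intro equalityI subsetI)
    fix f assume "f \<in> Fix G \<rho> (nc G S c v)"
    then have f: "linear f" "\<And>z. f (\<rho> (inv ?g) z) = f z"
      unfolding nc Fix_def dual_action_def by (auto dest: fun_cong)
    have fg: "f (\<rho> ?g z) = f z" for z using f(2)[of "\<rho> ?g z"] gG by simp
    \<comment> \<open>Pulling \<open>f\<close> back along \<open>v\<close> replaces invariance under
      \<open>nc\<close> by invariance under \<open>wp js\<close>.\<close>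
    define h where "h z = f (\<rho> v z)" for z
    have "linear h" unfolding h_def
      using linear_compose[OF linear_rho[OF vG] f(1)] by (simp add: comp_def)
    moreover have "h (\<rho> (wp js) z) = h z" for z
      using fg[of "\<rho> v z"] vG jsS unfolding h_def g by simp
    ultimately have "h (\<alpha> s) = 0" if "s \<in> J" for s
      using coxeter_invariant_functional_zero[OF JS finite_parabolic_descents[OF vG J_def] djs js(1)]
        that by blast
    then show "f \<in> annihilator (cov_roots v)"
      using f(1) by (auto simp: annihilator_def cov_roots_def J_def h_def linear_neg)
  next
    fix f assume f: "f \<in> annihilator (cov_roots v)"
    have lin: "linear f" using f by (simp add: annihilator_def)
    have t: "f (\<rho> t z) = f z" if "t \<in> set ts" for t z
    proof -
      obtain s where s: "s \<in> J" "t = ?conj s" using \<open>t \<in> set ts\<close> ts cov by auto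
      then have "f (\<rho> v (\<alpha> s)) = 0"
        using f by (auto simp: annihilator_def cov_roots_def J_def linear_neg)
      then show ?thesis
        using rho_reflection[OF vG _ HOL.refl, of s z] s JS
        by (auto simp: linear_diff[OF lin] linear_cmul[OF lin] simp del: rho_mult)
    qed
    have tsG: "set ts \<subseteq> carrier G" using ts(2) cov vG JS by auto
    have "f (\<rho> (wp us) z) = f z" if "set us \<subseteq> set ts" for us z
      using that
    proof (induction us)
      case (Cons a us)
      then have "a \<in> carrier G" "wp us \<in> carrier G" using tsG by (auto intro: word_prod_carrier_closed)
      then show ?case using Cons t by simp
    qed simp
    then have "f (\<rho> ?g z) = f z" for z by blast
    then have "f (\<rho> (inv ?g) z) = f z" for z using gG by (metis rho_inv_right)
    then show "f \<in> Fix G \<rho> (nc G S c v)"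
      unfolding nc Fix_def dual_action_def using lin by auto
  qed
qed

section \<open>Recovering the cover roots from the stabilizer\<close>

lemma reflection_in_Stab_iff:
  assumes w: "w \<in> carrier G" "s \<in> S" and lin: "\<And>f. f \<in> U \<Longrightarrow> linear f"
  shows "w \<otimes> s \<otimes> inv w \<in> Stab G \<rho> U \<longleftrightarrow> (\<forall>f\<in>U. f (\<rho> w (\<alpha> s)) = 0)"
proof -
  let ?b = "\<rho> w (\<alpha> s)" and ?t = "w \<otimes> s \<otimes> inv w"
  have t: "?t \<in> carrier G" "inv ?t = ?t" using w by (auto simp: inv_mult_group m_assoc)
  have f: "f (\<rho> ?t x) = f x - (2 * form ?b x / form ?b ?b) * f ?b" if "f \<in> U" for f x
    unfolding rho_reflection[OF w HOL.refl]
    using lin[OF that] by (simp add: linear_diff linear_cmul)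
  have b: "form ?b ?b \<noteq> 0" using form_root[OF w] \<delta>_pos[OF w(2)] by simp
  have "dual_action G \<rho> ?t f = f \<longleftrightarrow> f ?b = 0" if "f \<in> U" for f
  proof
    assume "dual_action G \<rho> ?t f = f"
    then have "f (\<rho> ?t ?b) = f ?b" unfolding dual_action_def t(2) by (rule fun_cong)
    then show "f ?b = 0" using f[OF that, of ?b] b by simp
  next
    assume "f ?b = 0"
    then show "dual_action G \<rho> ?t f = f" unfolding dual_action_def t(2) using f[OF that] by auto
  qed
  then show ?thesis using t unfolding Stab_def by auto
qed

text \<open>For \<open>r\<close> not a descent, \<open>coord r\<close> composed with
  \<open>inv v\<close> kills \<open>cov_roots v\<close>, hence kills \<open>b\<close>. So
  \<open>b\<close> is a combination of \<open>cov_roots v\<close>; its coefficients are those of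
  \<open>- \<rho> (inv v) b\<close> and have one sign, and the sign is fixed because
  \<open>v\<close> makes the simple roots at descents negative.\<close>

lemma annihilated_root:
  assumes v: "v \<in> carrier G" and b: "is_root b" "nonneg b"
    and ann: "\<forall>f\<in>annihilator (cov_roots v). f b = 0"
  shows "supported {s \<in> S. nonneg (- \<rho> v (\<alpha> s))} (\<rho> (inv v) b) \<and> nonneg (- \<rho> (inv v) b)"
proof
  let ?J = "{s \<in> S. nonneg (- \<rho> v (\<alpha> s))}" and ?e = "\<rho> (inv v) b"
  show s: "supported ?J ?e"
    unfolding supported_def
  proof
    fix r assume r: "r \<in> S - ?J"
    let ?f = "\<lambda>z. coord r (\<rho> (inv v) z)"
    have "linear ?f"
      using linear_compose[OF linear_rho[of "inv v"] linear_coord[of r]] v by (simp add: comp_def)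
    moreover have "?f z = 0" if "z \<in> cov_roots v" for z
      using that r v by (auto simp: cov_roots_def)
    ultimately show "?f b = 0" using ann by (auto simp: annihilator_def)
  qed
  show "nonneg (- ?e)"
  proof (rule ccontr)
    assume "\<not> nonneg (- ?e)"
    then have nn: "nonneg ?e" using root_cases root_rho b v by blast
    have "- b = - \<rho> v ?e" using v by simp
    also have "\<dots> = (\<Sum>s\<in>S. coord s ?e *\<^sub>R - \<rho> v (\<alpha> s))"
      by (subst (1) coord_expansion[of ?e]) (use v in \<open>simp add: rho_sum sum_negf\<close>)
    finally have e: "- b = (\<Sum>s\<in>S. coord s ?e *\<^sub>R - \<rho> v (\<alpha> s))" .
    have "nonneg (- b)"
      unfolding e
    proof (rule nonneg_sum)
      fix r assume r: "r \<in> S"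
      show "nonneg (coord r ?e *\<^sub>R - \<rho> v (\<alpha> r))"
      proof (cases "r \<in> ?J")
        case True
        then show ?thesis using nn by (intro nonneg_scale) (auto simp: nonneg_def)
      next
        case False
        then show ?thesis using s r by (simp add: supported_def nonneg_def)
      qed
    qed
    then show False using b root_nonneg_exclusive by blast
  qed
qed

text \<open>Each \<open>b\<close> in \<open>cov_roots v\<close> is a nonnegative combination of
  \<open>cov_roots v'\<close>, and these in turn are nonnegative combinations of
  \<open>cov_roots v\<close>. As \<open>b\<close> is extremal in the cone spanned by
  \<open>cov_roots v\<close>, it must be one of the terms.\<close>

lemma cov_roots_annihilator_mono:
  assumes v: "v \<in> carrier G" and v': "v' \<in> carrier G"
    and eq: "\<And>b. is_root b \<Longrightarrow> nonneg b \<Longrightarrow>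
      (\<forall>f\<in>annihilator (cov_roots v). f b = 0) \<longleftrightarrow> (\<forall>f\<in>annihilator (cov_roots v'). f b = 0)"
  shows "cov_roots v \<subseteq> cov_roots v'"
proof
  fix b assume bc: "b \<in> cov_roots v"
  then obtain s where s: "s \<in> S" "b = - \<rho> v (\<alpha> s)" "nonneg b" by (auto simp: cov_roots_def)
  have br: "is_root b" using s v root_minus by blast
  let ?J = "{s \<in> S. nonneg (- \<rho> v' (\<alpha> s))}" and ?e = "\<rho> (inv v') b"
  have "\<forall>f\<in>annihilator (cov_roots v). f b = 0" using bc by (auto simp: annihilator_def)
  then have e: "supported ?J ?e" "nonneg (- ?e)"
    using annihilated_root[OF v' br s(3)] eq[OF br s(3)] by blast+
  define k where "k t = - coord t ?e" for t
  \<comment> \<open>\<open>- \<rho> (inv v)\<close> sends \<open>b\<close> to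
    \<open>\<alpha> s\<close>, so \<open>g t\<close> is the candidate
    \<open>- \<rho> v' (\<alpha> t)\<close> seen in coordinates where \<open>cov_roots v\<close>
    consists of simple roots.\<close>
  define g where "g t = - \<rho> (inv v) (- \<rho> v' (\<alpha> t))" for t
  have k: "0 \<le> k t" if "t \<in> S" for t using e(2) that by (auto simp: nonneg_def k_def)
  have k0: "k t = 0" if "t \<in> S" "t \<notin> ?J" for t
    using e(1) that by (auto simp: supported_def k_def)
  have gr: "is_root (g t)" if "t \<in> S" for t
    unfolding g_def using v v' that by (intro root_minus root_rho) auto
  have gn: "nonneg (g t)" if t: "t \<in> ?J" for t
  proof -
    let ?d = "- \<rho> v' (\<alpha> t)"
    have d: "is_root ?d" "nonneg ?d" using t v' root_minus by auto
    have "\<forall>f\<in>annihilator (cov_roots v'). f ?d = 0"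
      using t by (auto simp: annihilator_def cov_roots_def)
    then show ?thesis unfolding g_def using annihilated_root[OF v d] eq[OF d] by blast
  qed
  have "\<alpha> s = - \<rho> (inv v) (\<rho> v' ?e)" using s v v' by simp
  also have "\<dots> = (\<Sum>t\<in>S. k t *\<^sub>R g t)"
    by (subst (1) coord_expansion[of ?e]) (use v v' in \<open>simp add: rho_sum sum_negf k_def g_def\<close>)
  finally have sum: "\<alpha> s = (\<Sum>t\<in>S. k t *\<^sub>R g t)" .
  have "?e \<noteq> 0" using root_nonzero root_rho br v' by blast
  then obtain r where r: "r \<in> S" "coord r ?e \<noteq> 0" using coord_ext[of ?e 0] by auto
  then have kr: "0 < k r" using k[of r] by (simp add: k_def)
  then have rJ: "r \<in> ?J" using k0[OF r(1)] by force
  have "g r = \<alpha> s"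
  proof (rule simple_root_extremal[OF finite_gens r(1) s(1) sum _ kr gr[OF r(1)] gn[OF rJ]])
    show "nonneg (k t *\<^sub>R g t)" if "t \<in> S" for t
    proof (cases "t \<in> ?J")
      case True
      then show ?thesis using gn k that by (intro nonneg_scale) auto
    next
      case False
      then show ?thesis using k0[OF that] by (simp add: nonneg_def)
    qed
  qed
  then have "\<rho> (inv v) (\<rho> v' (\<alpha> r)) = \<alpha> s" using v v' by (simp add: g_def)
  then have "\<rho> v' (\<alpha> r) = \<rho> v (\<alpha> s)" using v by (metis rho_inv_right)
  then have "b = - \<rho> v' (\<alpha> r)" using s by simp
  then show "b \<in> cov_roots v'" using rJ by (auto simp: cov_roots_def)
qed

lemma Stab_annihilator_determines:
  assumes v: "v \<in> carrier G" and v': "v' \<in> carrier G"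
    and eq: "Stab G \<rho> (annihilator (cov_roots v)) = Stab G \<rho> (annihilator (cov_roots v'))"
  shows "cov_roots v = cov_roots v'"
proof -
  have e: "(\<forall>f\<in>annihilator (cov_roots v). f b = 0) \<longleftrightarrow> (\<forall>f\<in>annihilator (cov_roots v'). f b = 0)"
    if "is_root b" for b
  proof -
    obtain w s where w: "w \<in> carrier G" "s \<in> S" and b: "b = \<rho> w (\<alpha> s)"
      using \<open>is_root b\<close> by (auto simp: is_root_def)
    have "w \<otimes> s \<otimes> inv w \<in> Stab G \<rho> (annihilator B) \<longleftrightarrow> (\<forall>f\<in>annihilator B. f b = 0)" for B
      unfolding b by (rule reflection_in_Stab_iff[OF w]) (simp add: annihilator_def)
    from this[of "cov_roots v"] this[of "cov_roots v'"] show ?thesis unfolding eq by simp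
  qed
  show ?thesis
  proof
    show "cov_roots v \<subseteq> cov_roots v'"
      by (rule cov_roots_annihilator_mono[OF v v' e])
    show "cov_roots v' \<subseteq> cov_roots v"
      by (rule cov_roots_annihilator_mono[OF v' v e[symmetric]])
  qed
qed

theorem nc_cov_injective:
  assumes c: "coxeter_word S c"
  shows "inj_on (\<lambda>v. Stab G \<rho> (Fix G \<rho> (nc G S c v))) (sortable G S c)"
    and "inj_on (cov G S) (sortable G S c)"
proof -
  have G: "v \<in> carrier G" if "v \<in> sortable G S c" for v using that by (simp add: sortable_def)
  show "inj_on (\<lambda>v. Stab G \<rho> (Fix G \<rho> (nc G S c v))) (sortable G S c)"
  proof (rule inj_onI)
    fix v v' assume v: "v \<in> sortable G S c" "v' \<in> sortable G S c"
      and "Stab G \<rho> (Fix G \<rho> (nc G S c v)) = Stab G \<rho> (Fix G \<rho> (nc G S c v'))"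
    then have "cov_roots v = cov_roots v'"
      using Stab_annihilator_determines G Fix_nc[OF c] by simp
    then show "v = v'" using sortable_eqI[OF c v] by blast
  qed
  show "inj_on (cov G S) (sortable G S c)"
  proof (rule inj_onI)
    fix v v' assume v: "v \<in> sortable G S c" "v' \<in> sortable G S c" and "cov G S v = cov G S v'"
    then have "cov_roots v = cov_roots v'"
      using cov_roots_mono G by (metis order_refl subset_antisym)
    then show "v = v'" using sortable_eqI[OF c v] by blast
  qed
qed

end

theorem theorem8p9:
  fixes G :: "('a, 'b) monoid_scheme"
    and S :: "'a set"
    and m :: "'a \<Rightarrow> 'a \<Rightarrow> enat"
    and A :: "'a \<Rightarrow> 'a \<Rightarrow> real"
    and \<alpha> :: "'a \<Rightarrow> 'v::real_vector"
    and \<rho> :: "'a \<Rightarrow> 'v \<Rightarrow> 'v"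
    and c :: "'a list"
  assumes "reflection_representation G S m A \<alpha> \<rho>"
    and "finite S"
    and "coxeter_word S c"
  shows "inj_on (nc G S c) (sortable G S c)
    \<and> inj_on (\<lambda>v. Fix G \<rho> (nc G S c v)) (sortable G S c)
    \<and> inj_on (\<lambda>v. Stab G \<rho> (Fix G \<rho> (nc G S c v))) (sortable G S c)
    \<and> inj_on (cov G S) (sortable G S c)"
proof -
  interpret reflection_representation G S m A \<alpha> \<rho> by fact
  obtain \<delta> :: "'a \<Rightarrow> real" where \<delta>: "\<forall>s\<in>S. \<delta> s > 0"
    "\<forall>s\<in>S. \<forall>t\<in>S. \<delta> s * A s t = \<delta> t * A t s"
    "\<forall>s\<in>S. \<forall>t\<in>S. conjugate_in G s t \<longrightarrow> \<delta> s = \<delta> t"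
    using symmetrizable by (auto simp: symmetrizable_def)
  interpret finite_reflection_representation G S m A \<alpha> \<rho> \<delta>
  proof (rule finite_reflection_representation.intro[OF assms(1)],
      rule finite_reflection_representation_axioms.intro)
    show "finite S" by fact
    fix s t assume s: "s \<in> S"
    show "\<delta> s > 0" using \<delta>(1) s by blast
    assume t: "t \<in> S"
    show "\<delta> s * A s t = \<delta> t * A t s" using \<delta>(2) s t by blast
    show "\<delta> s = \<delta> t" if "conjugate_in G s t" using \<delta>(3) s t that by blast
  qed
  have "inj_on (\<lambda>v. Stab G \<rho> (Fix G \<rho> (nc G S c v))) (sortable G S c)"
    "inj_on (cov G S) (sortable G S c)"
    using nc_cov_injective[OF assms(3)] .
  \<comment> \<open>The stabilizer is computed from the fixed space and the fixed space from
    \<open>nc\<close>, so injectivity of the third map yields that of the first two.\<close>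
  then show ?thesis unfolding inj_on_def by simp
qed

end
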